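(* There is an absolute constant $C>0$ such that for every $\varepsilon>0$, every $n$, every $f\colon\{0,1\}^n\times\{0,1\}^n\to\{0,1\}$ and every distribution $\mu$ on $\{0,1\}^n\times\{0,1\}^n$, \[ \mathrm{IC}^{\mathrm{external}}_{\mu}[f,\varepsilon]\le\frac{C}{\varepsilon^2}\Big(\lim_{q\to\infty}\frac1q\mathrm{CC}_{\mu^q}[f^q,0]\Big)^2 . \]
   Context: Protocols are two-party randomized communication protocols (Alice holds $x$, Bob holds $y$; output is a function of the transcript). For $q\in\mathbb{N}$, $f^q$ maps $((x_1,\dots,x_q),(y_1,\dots,y_q))$ to $(f(x_1,y_1),\dots,f(x_q,y_q))$ and $\mu^q$ is the product distribution. $\mathrm{CC}_{\nu}[g,0]$ is the infimum, over protocols that output $g(x,y)$ correctly with probability $1$ on every input (including those outside the support of $\nu$), of the expected number of bits communicated when $(x,y)\sim\nu$. With $(X,Y)\sim\mu$, the external information of a protocol is $I(\Pi(X,Y);X,Y)$, and $\mathrm{IC}^{\mathrm{external}}_\mu[f,\varepsilon]$ is its infimum over protocols with $\Pr_{(x,y)\sim\mu}[\mathrm{output}(\Pi(x,y))\ne f(x,y)]\le\varepsilon$. *)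

theory Defs
  imports "HOL-Probability.Probability"
begin

text \<open>A protocol is a (possibly infinite) binary protocol tree, whose nodes are the
finite transcripts (bit lists).  At each node it is Alice's turn, Bob's turn, or the
protocol has halted.  When it is Alice's turn she sends the bit True with probability
pA x h (depending on her input x and the transcript h so far), using her private
randomness; similarly for Bob.  At a halting node the output is outp h, a function
of the transcript only.\<close>

datatype turn = AliceT | BobT | HaltT

record ('a, 'b, 'o) protocol =
  turn :: "bool list \<Rightarrow> turn"
  pA :: "'a \<Rightarrow> bool list \<Rightarrow> real"
  pB :: "'b \<Rightarrow> bool list \<Rightarrow> real"
  outp :: "bool list \<Rightarrow> 'o"

definition step_prob :: "('a, 'b, 'o) protocol \<Rightarrow> 'a \<Rightarrow> 'b \<Rightarrow> bool list \<Rightarrow> bool \<Rightarrow> real" where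
  "step_prob P x y h b = (case turn P h of
       AliceT \<Rightarrow> (if b then pA P x h else 1 - pA P x h)
     | BobT \<Rightarrow> (if b then pB P y h else 1 - pB P y h)
     | HaltT \<Rightarrow> 0)"

definition trans_prob :: "('a, 'b, 'o) protocol \<Rightarrow> 'a \<Rightarrow> 'b \<Rightarrow> bool list \<Rightarrow> real" where
  "trans_prob P x y t =
     (if turn P t = HaltT then (\<Prod>i<length t. step_prob P x y (take i t) (t ! i)) else 0)"

text \<open>Valid protocol on input domain A \<times> B: probabilities in [0,1] and the protocol
halts with probability 1 on every input of the domain.\<close>
definition valid_protocol :: "('a, 'b, 'o) protocol \<Rightarrow> 'a set \<Rightarrow> 'b set \<Rightarrow> bool" where
  "valid_protocol P A B \<longleftrightarrow>
     (\<forall>x h. 0 \<le> pA P x h \<and> pA P x h \<le> 1) \<and>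
     (\<forall>y h. 0 \<le> pB P y h \<and> pB P y h \<le> 1) \<and>
     (\<forall>x\<in>A. \<forall>y\<in>B. (trans_prob P x y has_sum 1) UNIV)"

definition zero_error :: "('a, 'b, 'o) protocol \<Rightarrow> 'a set \<Rightarrow> 'b set \<Rightarrow> ('a \<Rightarrow> 'b \<Rightarrow> 'o) \<Rightarrow> bool" where
  "zero_error P A B g \<longleftrightarrow>
     (\<forall>x\<in>A. \<forall>y\<in>B. \<forall>t. trans_prob P x y t \<noteq> 0 \<longrightarrow> outp P t = g x y)"

definition error_prob :: "('a \<times> 'b) pmf \<Rightarrow> ('a, 'b, 'o) protocol \<Rightarrow> ('a \<Rightarrow> 'b \<Rightarrow> 'o) \<Rightarrow> real" where
  "error_prob \<mu> P g = (\<Sum>(x, y)\<in>set_pmf \<mu>. pmf \<mu> (x, y) *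
       infsum (\<lambda>t. if outp P t \<noteq> g x y then trans_prob P x y t else 0) UNIV)"

definition exp_comm :: "('a \<times> 'b) pmf \<Rightarrow> ('a, 'b, 'o) protocol \<Rightarrow> ennreal" where
  "exp_comm \<nu> P = (\<Sum>(x, y)\<in>set_pmf \<nu>. ennreal (pmf \<nu> (x, y)) *
       (\<integral>\<^sup>+ t. ennreal (trans_prob P x y t * real (length t)) \<partial>count_space UNIV))"

definition trans_marg :: "('a \<times> 'b) pmf \<Rightarrow> ('a, 'b, 'o) protocol \<Rightarrow> bool list \<Rightarrow> real" where
  "trans_marg \<mu> P t = (\<Sum>(x, y)\<in>set_pmf \<mu>. pmf \<mu> (x, y) * trans_prob P x y t)"

text \<open>External information I(Pi(X,Y); X,Y) (in bits), for mu of finite support.\<close>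
definition ext_info :: "('a \<times> 'b) pmf \<Rightarrow> ('a, 'b, 'o) protocol \<Rightarrow> real" where
  "ext_info \<mu> P = infsum (\<lambda>t. \<Sum>(x, y)\<in>set_pmf \<mu>. pmf \<mu> (x, y) * trans_prob P x y t *
       log 2 (trans_prob P x y t / trans_marg \<mu> P t)) UNIV"

definition CC0 :: "'a set \<Rightarrow> 'b set \<Rightarrow> ('a \<times> 'b) pmf \<Rightarrow> ('a \<Rightarrow> 'b \<Rightarrow> 'o) \<Rightarrow> ennreal" where
  "CC0 A B \<nu> g = (INF P \<in> {P :: ('a, 'b, 'o) protocol. valid_protocol P A B \<and> zero_error P A B g}.
       exp_comm \<nu> P)"

definition IC_ext :: "'a set \<Rightarrow> 'b set \<Rightarrow> ('a \<times> 'b) pmf \<Rightarrow> ('a \<Rightarrow> 'b \<Rightarrow> 'o) \<Rightarrow> real \<Rightarrow> real" where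
  "IC_ext A B \<mu> g \<epsilon> = Inf {ext_info \<mu> P | P :: ('a, 'b, 'o) protocol.
       valid_protocol P A B \<and> error_prob \<mu> P g \<le> \<epsilon>}"

definition cube :: "nat \<Rightarrow> bool list set" where
  "cube n = {x. length x = n}"

definition cube_pow :: "nat \<Rightarrow> nat \<Rightarrow> bool list list set" where
  "cube_pow n q = {xs. length xs = q \<and> (\<forall>x\<in>set xs. length x = n)}"

definition f_pow :: "('a \<Rightarrow> 'b \<Rightarrow> 'o) \<Rightarrow> 'a list \<Rightarrow> 'b list \<Rightarrow> 'o list" where
  "f_pow f xs ys = map2 f xs ys"

fun mu_pow :: "('a \<times> 'b) pmf \<Rightarrow> nat \<Rightarrow> ('a list \<times> 'b list) pmf" where
  "mu_pow \<mu> 0 = return_pmf ([], [])"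
| "mu_pow \<mu> (Suc q) =
     bind_pmf \<mu> (\<lambda>(x, y). bind_pmf (mu_pow \<mu> q) (\<lambda>(xs, ys). return_pmf (x # xs, y # ys)))"

end

theory Submission
  imports Defs
begin

text \<open>A transcript t of a zero-error protocol for \<open>f\<^sup>q\<close> is consistent with a combinatorial rectangle
of inputs, and the projections of this rectangle to the q coordinates are monochromatic for f.
Weighting t by \<open>2\<^sup>-\<^sup>|\<^sup>t\<^sup>|\<close> gives a prior on q-tuples of monochromatic rectangles under which the
negative logarithm of the mass of the tuples containing the input is on average at most the
communication.  Conditioning on the first coordinate shows that this quantity tensorizes, so
there is one distribution P on monochromatic rectangles of f with
\<open>E (- log P(R \<ni> (x, y))) \<le> K\<close>, where K is the amortized cost.  By Markov's inequality all inputs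
outside a set of measure \<open>\<epsilon>\<close> lie in a P-random rectangle with probability more than
\<open>\<delta> = 2 powr (- K / \<epsilon>)\<close>.  If \<open>\<delta> \<ge> 1/2\<close>, any two such inputs share a rectangle and f is constant on
them.  Otherwise one runs the classical protocol that maintains a set of live 0-rectangles and
halves its P-measure whenever a player names a 1-rectangle meeting at most half of it.
The name is sampled from P conditioned on an event of probability at least \<open>\<delta> / 2\<close>, so each of the
at most \<open>\<lceil>K / \<epsilon>\<rceil>\<close> rounds reveals \<open>O(K / \<epsilon>)\<close> bits.\<close>

subsection \<open>Subadditive sequences\<close>

lemma subadditive_mult_le:
  fixes a :: "nat \<Rightarrow> real"
  assumes sub: "\<And>m n. a (m + n) \<le> a m + a n" 
  shows "a (k * m + r) \<le> real k * a m + a r"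
proof (induction k)
  case 0 then show ?case by simp
next
  case (Suc k)
  have "a (Suc k * m + r) \<le> a m + a (k * m + r)"
    using sub[of m "k * m + r"] by (simp add: algebra_simps)
  with Suc show ?case by (simp add: algebra_simps)
qed

text \<open>Fekete's lemma, with the infimum of the ratios as limit. Dividing n by a fixed m leaves
  a remainder whose cost is bounded by a constant, and this vanishes after division by n.
  Convergence matters because \<open>lim\<close> is meaningful only for convergent
  sequences.\<close>

lemma fekete_convergent:
  fixes a :: "nat \<Rightarrow> real"
  assumes sub: "\<And>m n. a (m + n) \<le> a m + a n" and nonneg: "\<And>n. 0 \<le> a n"
  shows "convergent (\<lambda>n. a n / real n)"
proof -
  define L where "L = (INF m\<in>{0<..}. a m / real m)"
  have bdd: "bdd_below ((\<lambda>m. a m / real m) ` {0<..})"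
    by (rule bdd_belowI[of _ 0]) (use nonneg in auto)
  have L_le: "L \<le> a m / real m" if "m > 0" for m
    unfolding L_def by (rule cINF_lower[OF bdd]) (use that in auto)
  have "(\<lambda>n. a n / real n) \<longlonglongrightarrow> L"
  proof (rule LIMSEQ_I)
    fix e :: real assume e: "0 < e"
    have "\<exists>m\<in>{0<..}. a m / real m < L + e / 2"
      unfolding L_def by (subst cINF_less_iff[symmetric, OF _ bdd]) (use e in auto)
    then obtain m where m: "m > 0" "a m / real m < L + e / 2" by auto
    define M where "M = (\<Sum>r<m. a r)"
    have M: "a r \<le> M" if "r < m" for r
      unfolding M_def by (rule member_le_sum) (use that nonneg in auto)
    obtain N :: nat where N: "M / (e / 2) < real N" using reals_Archimedean2 by blast
    show "\<exists>no. \<forall>n\<ge>no. norm (a n / real n - L) < e"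
    proof (intro exI allI impI)
      fix n assume n: "n \<ge> max 1 N"
      have "a n \<le> real (n div m) * a m + a (n mod m)"
        using subadditive_mult_le[of a "n div m" m "n mod m"] sub by simp
      also have "\<dots> \<le> real n / real m * a m + M"
      proof -
        have "real (n div m) \<le> real n / real m" by (rule of_nat_div_le_of_nat)
        thus ?thesis using M[of "n mod m"] m(1) nonneg[of m]
          by (intro add_mono mult_right_mono) auto
      qed
      finally have "a n / real n \<le> a m / real m + M / real n"
        using n m(1) by (simp add: field_simps)
      moreover have "M / real n < e / 2"
      proof -
        have "M < real N * (e/2)" using N e by (simp add: field_simps)
        also have "\<dots> \<le> real n * (e/2)" using n e by (intro mult_right_mono) auto
        finally show ?thesis using n e by (simp add: field_simps)
      qed
      moreover have "L \<le> a n / real n" using L_le[of n] n by auto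
      ultimately show "norm (a n / real n - L) < e" using m(2) unfolding real_norm_def by linarith
    qed
  qed
  thus ?thesis by (rule convergentI)
qed

subsection \<open>Transcript distributions\<close>

lemma step_prob_nonneg:
  assumes "valid_protocol P A B"
  shows "0 \<le> step_prob P x y h b"
  using assms unfolding valid_protocol_def step_prob_def by (auto split: turn.splits)

lemma trans_prob_nonneg:
  assumes "valid_protocol P A B"
  shows "0 \<le> trans_prob P x y t"
  unfolding trans_prob_def using step_prob_nonneg[OF assms] by (auto intro!: prod_nonneg)

text \<open>Bridge between validity, which is phrased with \<open>has_sum\<close>, and
  \<open>embed_pmf\<close>, which asks for an integral over the counting measure.\<close>

lemma nn_integral_count_space_has_sum:
  fixes g :: "'a \<Rightarrow> real"
  assumes "(g has_sum c) UNIV" "\<And>x. 0 \<le> g x"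
  shows "(\<integral>\<^sup>+ x. ennreal (g x) \<partial>count_space UNIV) = ennreal c"
proof -
  have summ: "g summable_on UNIV" using assms(1) by (rule has_sum_imp_summable)
  have ab: "Infinite_Set_Sum.abs_summable_on g UNIV"
    by (rule abs_summable_equivalent[THEN iffD1], rule summable_on_cong[THEN iffD1, OF _ summ])
       (simp add: assms(2))
  hence "(\<integral>\<^sup>+ x. ennreal (g x) \<partial>count_space UNIV) = ennreal (infsetsum g UNIV)"
    by (rule nn_integral_conv_infsetsum) (rule assms(2))
  also have "infsetsum g UNIV = infsum g UNIV" using ab by (rule infsetsum_infsum)
  also have "\<dots> = c" using assms(1) by (rule infsumI)
  finally show ?thesis .
qed

lemma has_sum_pmf: "(pmf p has_sum 1) UNIV"
proof -
  have ab: "Infinite_Set_Sum.abs_summable_on (pmf p) UNIV" by (rule pmf_abs_summable)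
  hence "pmf p summable_on UNIV"
    by (rule abs_summable_summable[OF abs_summable_equivalent[THEN iffD2]])
  moreover have "infsum (pmf p) UNIV = 1"
    using infsetsum_infsum[OF ab] infsetsum_pmf_eq_1[of p UNIV] by simp
  ultimately show ?thesis by (metis has_sum_infsum)
qed

text \<open>Meaningful only where the transcript probabilities are nonnegative and sum to 1; hence
  the validity and domain hypotheses in the lemmas about it.\<close>

definition trans_pmf :: "('a, 'b, 'o) protocol \<Rightarrow> 'a \<Rightarrow> 'b \<Rightarrow> bool list pmf" where
  "trans_pmf P x y = embed_pmf (trans_prob P x y)"

lemma pmf_trans_pmf:
  assumes "valid_protocol P A B" "x \<in> A" "y \<in> B"
  shows "pmf (trans_pmf P x y) t = trans_prob P x y t"
  unfolding trans_pmf_def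
proof (rule pmf_embed_pmf)
  show "(\<integral>\<^sup>+ t. ennreal (trans_prob P x y t) \<partial>count_space UNIV) = 1"
    using nn_integral_count_space_has_sum[of "trans_prob P x y" 1] assms trans_prob_nonneg[OF assms(1)]
    by (simp add: valid_protocol_def)
qed (rule trans_prob_nonneg[OF assms(1)])

lemma set_trans_pmf:
  assumes "valid_protocol P A B" "x \<in> A" "y \<in> B"
  shows "set_pmf (trans_pmf P x y) = {t. trans_prob P x y t \<noteq> 0}"
  using pmf_trans_pmf[OF assms] by (auto simp: set_pmf_eq)

definition cost :: "('a, 'b, 'o) protocol \<Rightarrow> 'a \<Rightarrow> 'b \<Rightarrow> ennreal" where
  "cost P x y = (\<integral>\<^sup>+ t. ennreal (trans_prob P x y t * real (length t)) \<partial>count_space UNIV)"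

lemma cost_trans_pmf:
  assumes "valid_protocol P A B" "x \<in> A" "y \<in> B"
  shows "cost P x y = (\<integral>\<^sup>+ t. ennreal (real (length t)) \<partial>trans_pmf P x y)"
  unfolding nn_integral_measure_pmf cost_def pmf_trans_pmf[OF assms]
  using trans_prob_nonneg[OF assms(1)] by (simp add: ennreal_mult)

lemma exp_comm_nn_integral:
  assumes "finite (set_pmf \<nu>)"
  shows "exp_comm \<nu> P = (\<integral>\<^sup>+ z. cost P (fst z) (snd z) \<partial>\<nu>)"
  unfolding exp_comm_def nn_integral_measure_pmf_finite[OF assms zero_le] cost_def
  by (rule sum.cong) (simp_all add: case_prod_unfold mult.commute)

subsection \<open>Sequential composition\<close>

definition halted :: "('a, 'b, 'o) protocol \<Rightarrow> bool list \<Rightarrow> bool" where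
  "halted P h \<longleftrightarrow> (\<exists>i\<le>length h. turn P (take i h) = HaltT)"

definition halt_time :: "('a, 'b, 'o) protocol \<Rightarrow> bool list \<Rightarrow> nat" where
  "halt_time P h = (LEAST i. i \<le> length h \<and> turn P (take i h) = HaltT)"

text \<open>\<open>P\<close> runs on the first \<open>q\<close> coordinates, then \<open>Q\<close>
  on the others. The transcript carries no separator: the handover point is the first prefix at
  which \<open>P\<close> halts, which both players can recognise.\<close>

definition seq_comp :: "nat \<Rightarrow> ('a list, 'b list, 'o list) protocol \<Rightarrow> ('a list, 'b list, 'o list) protocol
    \<Rightarrow> ('a list, 'b list, 'o list) protocol" where
  "seq_comp q P Q = \<lparr>
     turn = (\<lambda>h. if halted P h then turn Q (drop (halt_time P h) h) else turn P h),
     pA = (\<lambda>x h. if halted P h then pA Q (drop q x) (drop (halt_time P h) h) else pA P (take q x) h),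
     pB = (\<lambda>y h. if halted P h then pB Q (drop q y) (drop (halt_time P h) h) else pB P (take q y) h),
     outp = (\<lambda>h. outp P (take (halt_time P h) h) @ outp Q (drop (halt_time P h) h))\<rparr>"

lemma halt_timeD:
  assumes "halted P h"
  shows "halt_time P h \<le> length h" "turn P (take (halt_time P h) h) = HaltT"
    "\<And>i. i < halt_time P h \<Longrightarrow> turn P (take i h) \<noteq> HaltT"
proof -
  obtain i where "i \<le> length h \<and> turn P (take i h) = HaltT" using assms by (auto simp: halted_def)
  from LeastI[of "\<lambda>i. i \<le> length h \<and> turn P (take i h) = HaltT", OF this]
  show *: "halt_time P h \<le> length h" "turn P (take (halt_time P h) h) = HaltT" 
    by (auto simp: halt_time_def)
  show "turn P (take i h) \<noteq> HaltT" if "i < halt_time P h" for i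
    using not_less_Least[of i "\<lambda>i. i \<le> length h \<and> turn P (take i h) = HaltT"] that *(1)
    by (auto simp: halt_time_def)
qed

lemma halt_time_take:
  assumes "halted P h" "halt_time P h \<le> j"
  shows "halted P (take j h)" "halt_time P (take j h) = halt_time P h"
proof -
  note H = halt_timeD[OF assms(1)]
  show h: "halted P (take j h)"
    unfolding halted_def using H(1,2) assms(2) by (auto intro!: exI[of _ "halt_time P h"] simp: min_def)
  show "halt_time P (take j h) = halt_time P h"
    unfolding halt_time_def[of P "take j h"]
    by (rule Least_equality) (use H assms(2) in \<open>auto simp: min_def not_less[symmetric]\<close>)
qed

lemma not_halted_take:
  assumes "halted P h" "j < halt_time P h"
  shows "\<not> halted P (take j h)"
  using halt_timeD(3)[OF assms(1)] assms(2) unfolding halted_def by (auto simp: min_def)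

text \<open>At a halting node every step has probability 0, so a possible transcript has no halting
  proper prefix. Possible transcripts are therefore prefix-free.\<close>

lemma trans_prob_not_haltedD:
  assumes "trans_prob P x y t \<noteq> 0"
  shows "turn P t = HaltT" "i < length t \<Longrightarrow> turn P (take i t) \<noteq> HaltT"
    "i < length t \<Longrightarrow> step_prob P x y (take i t) (t ! i) \<noteq> 0"
proof -
  show "turn P t = HaltT" using assms by (auto simp: trans_prob_def split: if_splits)
  show *: "step_prob P x y (take i t) (t ! i) \<noteq> 0" if "i < length t" for i
    using assms that by (auto simp: trans_prob_def split: if_splits)
  show "turn P (take i t) \<noteq> HaltT" if "i < length t"
    using *[OF that] by (auto simp: step_prob_def)
qed

lemma halt_time_append:
  assumes "trans_prob P x y t \<noteq> 0"
  shows "halted P (t @ s)" "halt_time P (t @ s) = length t"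
proof -
  note T = trans_prob_not_haltedD[OF assms]
  show "halted P (t @ s)" unfolding halted_def using T(1) by (auto intro!: exI[of _ "length t"])
  show "halt_time P (t @ s) = length t"
    unfolding halt_time_def
    by (rule Least_equality) (use T(1,2) in \<open>auto simp: not_less[symmetric]\<close>)
qed

text \<open>The product over the bits of \<open>u\<close> is cut at the handover point: no shorter
  prefix counts as halted, and all longer prefixes have the same handover point.\<close>

lemma trans_prob_seq_comp:
  "trans_prob (seq_comp q P Q) xs ys u =
    (if halted P u then trans_prob P (take q xs) (take q ys) (take (halt_time P u) u) *
        trans_prob Q (drop q xs) (drop q ys) (drop (halt_time P u) u) else 0)"
proof (cases "halted P u")
  case False
  hence "turn (seq_comp q P Q) u = turn P u" "turn P u \<noteq> HaltT"
    by (auto simp: seq_comp_def halted_def)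
  thus ?thesis using False by (simp add: trans_prob_def)
next
  case True
  define m where "m = halt_time P u"
  define R where "R = seq_comp q P Q"
  note H = halt_timeD[OF True, folded m_def]
  have 1: "step_prob R xs ys (take i u) (u ! i) = step_prob P (take q xs) (take q ys) (take i (take m u)) (take m u ! i)"
    if "i < m" for i
    using not_halted_take[OF True, of i] that H(1)
    by (auto simp: step_prob_def R_def seq_comp_def m_def min_def split: turn.splits)
  have 2: "step_prob R xs ys (take (m + i) u) (u ! (m + i)) = step_prob Q (drop q xs) (drop q ys) (take i (drop m u)) (drop m u ! i)"
    if "i < length u - m" for i
    using halt_time_take[OF True, of "m + i"] that H(1)
    by (auto simp: step_prob_def R_def seq_comp_def m_def[symmetric] drop_take split: turn.splits)
  have split: "(\<Prod>i<m + r. g i) = (\<Prod>i<m. g i) * (\<Prod>i<r. g (m + i))" for g :: "nat \<Rightarrow> real" and r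
    by (induction r) (simp_all add: mult.assoc)
  have "(\<Prod>i<length u. step_prob R xs ys (take i u) (u ! i)) =
     (\<Prod>i<m. step_prob R xs ys (take i u) (u ! i)) *
     (\<Prod>i<length u - m. step_prob R xs ys (take (m + i) u) (u ! (m + i)))"
    using split[of "\<lambda>i. step_prob R xs ys (take i u) (u ! i)" "length u - m"] H(1) by simp
  also have "\<dots> = (\<Prod>i<m. step_prob P (take q xs) (take q ys) (take i (take m u)) (take m u ! i)) *
     (\<Prod>i<length u - m. step_prob Q (drop q xs) (drop q ys) (take i (drop m u)) (drop m u ! i))"
    by (intro arg_cong2[of _ _ _ _ "(*)"] prod.cong refl 1 2) auto
  finally have "(\<Prod>i<length u. step_prob R xs ys (take i u) (u ! i)) = \<dots>" .
  moreover have "turn R u = turn Q (drop m u)" using True by (simp add: R_def seq_comp_def m_def)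
  ultimately show ?thesis using True H(1,2)
    by (simp add: trans_prob_def R_def[symmetric] m_def[symmetric] min_def)
qed

text \<open>The composed transcript is the concatenation of two independent ones. Concatenation is
  injective on the support because \<open>halt_time\<close> recovers the length of the first part.
  Validity and additivity of the cost follow from this description.\<close>

lemma trans_prob_seq_comp_pmf:
  assumes P: "valid_protocol P A B" "take q xs \<in> A" "take q ys \<in> B"
    and Q: "valid_protocol Q A' B'" "drop q xs \<in> A'" "drop q ys \<in> B'"
  shows "trans_prob (seq_comp q P Q) xs ys = pmf (map_pmf (\<lambda>r. fst r @ snd r) 
     (pair_pmf (trans_pmf P (take q xs) (take q ys)) (trans_pmf Q (drop q xs) (drop q ys))))"
    (is "_ = pmf (map_pmf ?f ?pq)")
proof
  fix u
  note S = set_trans_pmf[OF P] set_trans_pmf[OF Q]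
  have inj: "inj_on ?f (set_pmf ?pq)"
  proof (rule inj_onI)
    fix p p' assume p: "p \<in> set_pmf ?pq" and p': "p' \<in> set_pmf ?pq" and eq: "?f p = ?f p'"
    have len: "halt_time P (fst r @ snd r) = length (fst r)" if "r \<in> set_pmf ?pq" for r
    proof (rule halt_time_append(2))
      have "fst r \<in> set_pmf (trans_pmf P (take q xs) (take q ys))" using that by (simp add: mem_Times_iff)
      thus "trans_prob P (take q xs) (take q ys) (fst r) \<noteq> 0" unfolding S(1) by simp
    qed
    have "length (fst p) = length (fst p')" using len[OF p] len[OF p'] eq by metis
    thus "p = p'" using eq append_eq_append_conv[of "fst p" "fst p'"] by (auto intro: prod_eqI)
  qed
  show "trans_prob (seq_comp q P Q) xs ys u = pmf (map_pmf ?f ?pq) u"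
  proof (cases "u \<in> ?f ` set_pmf ?pq")
    case True
    then obtain t s where u: "u = t @ s" and ts: "(t, s) \<in> set_pmf ?pq" by auto
    hence t: "trans_prob P (take q xs) (take q ys) t \<noteq> 0" using S by auto
    have "pmf (map_pmf ?f ?pq) u = pmf ?pq (t, s)" using pmf_map_inj[OF inj ts] u by simp
    also have "\<dots> = trans_prob P (take q xs) (take q ys) t * trans_prob Q (drop q xs) (drop q ys) s"
      using pmf_trans_pmf[OF P] pmf_trans_pmf[OF Q] by (simp add: pmf_pair)
    finally show ?thesis unfolding trans_prob_seq_comp using halt_time_append[OF t, of s] u by simp
  next
    case False
    hence "pmf (map_pmf ?f ?pq) u = 0" by (rule pmf_map_outside)
    moreover have "trans_prob (seq_comp q P Q) xs ys u = 0"
    proof (rule ccontr)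
      assume *: "trans_prob (seq_comp q P Q) xs ys u \<noteq> 0"
      let ?m = "halt_time P u"
      have "(take ?m u, drop ?m u) \<in> set_pmf ?pq" using * S
        unfolding trans_prob_seq_comp by (auto split: if_splits)
      hence "?f (take ?m u, drop ?m u) \<in> ?f ` set_pmf ?pq" by (rule imageI)
      thus False using False by simp
    qed
    ultimately show ?thesis by simp
  qed
qed

lemma cube_pow_split:
  assumes "xs \<in> cube_pow n (q + r)"
  shows "take q xs \<in> cube_pow n q" "drop q xs \<in> cube_pow n r"
  using assms by (auto simp: cube_pow_def dest: in_set_takeD in_set_dropD)

lemma seq_comp_valid:
  assumes P: "valid_protocol P (cube_pow n q) (cube_pow n q)"
    and Q: "valid_protocol Q (cube_pow n r) (cube_pow n r)"
  shows "valid_protocol (seq_comp q P Q) (cube_pow n (q + r)) (cube_pow n (q + r))"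
proof -
  have "(trans_prob (seq_comp q P Q) xs ys has_sum 1) UNIV"
    if "xs \<in> cube_pow n (q + r)" "ys \<in> cube_pow n (q + r)" for xs ys
    unfolding trans_prob_seq_comp_pmf[OF P cube_pow_split(1)[OF that(1)] cube_pow_split(1)[OF that(2)] 
         Q cube_pow_split(2)[OF that(1)] cube_pow_split(2)[OF that(2)]]
    by (rule has_sum_pmf)
  thus ?thesis using P Q by (auto simp: valid_protocol_def seq_comp_def)
qed

lemma seq_comp_zero_error:
  assumes P: "zero_error P (cube_pow n q) (cube_pow n q) (f_pow f)"
    and Q: "zero_error Q (cube_pow n r) (cube_pow n r) (f_pow f)"
  shows "zero_error (seq_comp q P Q) (cube_pow n (q + r)) (cube_pow n (q + r)) (f_pow f)"
  unfolding zero_error_def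
proof (intro ballI allI impI)
  fix xs ys u
  assume xs: "xs \<in> cube_pow n (q + r)" and ys: "ys \<in> cube_pow n (q + r)"
    and "trans_prob (seq_comp q P Q) xs ys u \<noteq> 0"
  hence t: "trans_prob P (take q xs) (take q ys) (take (halt_time P u) u) \<noteq> 0"
    "trans_prob Q (drop q xs) (drop q ys) (drop (halt_time P u) u) \<noteq> 0"
    by (auto simp: trans_prob_seq_comp split: if_splits)
  have "outp (seq_comp q P Q) u = f_pow f (take q xs) (take q ys) @ f_pow f (drop q xs) (drop q ys)"
    using P Q t cube_pow_split[OF xs] cube_pow_split[OF ys]
    by (auto simp: seq_comp_def zero_error_def)
  also have "\<dots> = f_pow f xs ys"
    using xs ys by (simp add: f_pow_def cube_pow_def flip: map_append zip_append take_zip drop_zip)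
  finally show "outp (seq_comp q P Q) u = f_pow f xs ys" .
qed

lemma cost_seq_comp:
  assumes P: "valid_protocol P (cube_pow n q) (cube_pow n q)"
    and Q: "valid_protocol Q (cube_pow n r) (cube_pow n r)"
    and xs: "xs \<in> cube_pow n q" and ys: "ys \<in> cube_pow n q"
    and xs': "xs' \<in> cube_pow n r" and ys': "ys' \<in> cube_pow n r"
  shows "cost (seq_comp q P Q) (xs @ xs') (ys @ ys') = cost P xs ys + cost Q xs' ys'"
proof -
  have l: "length xs = q" "length ys = q" using xs ys by (auto simp: cube_pow_def)
  have "xs @ xs' \<in> cube_pow n (q + r)" "ys @ ys' \<in> cube_pow n (q + r)"
    using xs ys xs' ys' by (auto simp: cube_pow_def)
  note * = pmf_trans_pmf[OF seq_comp_valid[OF P Q] this] cost_trans_pmf[OF seq_comp_valid[OF P Q] this]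
  have "trans_pmf (seq_comp q P Q) (xs @ xs') (ys @ ys') = 
    map_pmf (\<lambda>r. fst r @ snd r) (pair_pmf (trans_pmf P xs ys) (trans_pmf Q xs' ys'))"
    by (rule pmf_eqI, subst *(1), subst trans_prob_seq_comp_pmf[OF P _ _ Q])
       (use xs ys xs' ys' l in auto)
  thus ?thesis unfolding *(2) cost_trans_pmf[OF P xs ys] cost_trans_pmf[OF Q xs' ys']
    by (simp add: nn_integral_pair_pmf' nn_integral_add)
qed

section \<open>Product distributions and subadditivity of the zero-error cost\<close>

lemma set_mu_pow:
  assumes "set_pmf \<mu> \<subseteq> cube n \<times> cube n"
  shows "set_pmf (mu_pow \<mu> q) \<subseteq> cube_pow n q \<times> cube_pow n q"
  using assms by (induction q) (fastforce simp: cube_pow_def cube_def set_bind_pmf)+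

lemma finite_cube: "finite (cube n)"
  using finite_lists_length_eq[of "UNIV :: bool set" n] by (simp add: cube_def)

lemma finite_cube_pow: "finite (cube_pow n q)"
  using finite_lists_length_eq[OF finite_cube, of n q] 
  by (simp add: cube_pow_def cube_def subset_iff Ball_def conj_commute)

lemma finite_mu_pow: "finite (set_pmf \<mu>) \<Longrightarrow> finite (set_pmf (mu_pow \<mu> q))"
  by (induction q) (auto simp: set_bind_pmf)

lemma mu_pow_add:
  "mu_pow \<mu> (q + r) = map_pmf (\<lambda>(z, z'). (fst z @ fst z', snd z @ snd z')) (pair_pmf (mu_pow \<mu> q) (mu_pow \<mu> r))"
  by (induction q)
     (simp_all add: pair_pmf_def map_bind_pmf bind_return_pmf bind_assoc_pmf map_return_pmf bind_return_pmf' case_prod_unfold)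

text \<open>Near-optimal protocols for the two blocks of coordinates are run one after the other.
  The infima need not be attained, hence the slack \<open>e\<close>, half of it for each
  block.\<close>

lemma CC0_subadditive:
  fixes f :: "bool list \<Rightarrow> bool list \<Rightarrow> 'o"
  assumes \<mu>: "set_pmf \<mu> \<subseteq> cube n \<times> cube n"
  defines "c \<equiv> \<lambda>q. CC0 (cube_pow n q) (cube_pow n q) (mu_pow \<mu> q) (f_pow f)"
  shows "c (q + r) \<le> c q + c r"
proof -
  define V where "V = (\<lambda>q. {P :: (bool list list, bool list list, 'o list) protocol. 
    valid_protocol P (cube_pow n q) (cube_pow n q) \<and> zero_error P (cube_pow n q) (cube_pow n q) (f_pow f)})"
  have c: "c q = (INF P\<in>V q. exp_comm (mu_pow \<mu> q) P)" for q by (simp add: c_def CC0_def V_def)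
  have le: "c (q + r) \<le> exp_comm (mu_pow \<mu> q) P + exp_comm (mu_pow \<mu> r) Q" if "P \<in> V q" "Q \<in> V r" for P Q
  proof -
    have v: "valid_protocol P (cube_pow n q) (cube_pow n q)" "valid_protocol Q (cube_pow n r) (cube_pow n r)"
      using that by (auto simp: V_def)
    note fin = finite_mu_pow[OF finite_subset[OF \<mu> finite_cartesian_product[OF finite_cube finite_cube]]]
    have "seq_comp q P Q \<in> V (q + r)"
      using that by (auto simp: V_def seq_comp_valid seq_comp_zero_error)
    hence "c (q + r) \<le> exp_comm (mu_pow \<mu> (q + r)) (seq_comp q P Q)"
      unfolding c by (rule INF_lower)
    also have "\<dots> = (\<integral>\<^sup>+ z. \<integral>\<^sup>+ z'. cost (seq_comp q P Q) (fst z @ fst z') (snd z @ snd z') \<partial>mu_pow \<mu> r \<partial>mu_pow \<mu> q)"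
      unfolding exp_comm_nn_integral[OF fin] by (simp add: mu_pow_add nn_integral_pair_pmf')
    also have "\<dots> = (\<integral>\<^sup>+ z. \<integral>\<^sup>+ z'. cost P (fst z) (snd z) + cost Q (fst z') (snd z') \<partial>mu_pow \<mu> r \<partial>mu_pow \<mu> q)"
    proof (intro nn_integral_cong_AE AE_pmfI)
      fix z z' assume "z \<in> set_pmf (mu_pow \<mu> q)" "z' \<in> set_pmf (mu_pow \<mu> r)"
      hence "z \<in> cube_pow n q \<times> cube_pow n q" "z' \<in> cube_pow n r \<times> cube_pow n r"
        by (auto intro!: subsetD[OF set_mu_pow[OF \<mu>]] simp del: mem_Times_iff)
      thus "cost (seq_comp q P Q) (fst z @ fst z') (snd z @ snd z') = cost P (fst z) (snd z) + cost Q (fst z') (snd z')"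
        by (intro cost_seq_comp[OF v]) auto
    qed
    also have "\<dots> = exp_comm (mu_pow \<mu> q) P + exp_comm (mu_pow \<mu> r) Q"
      unfolding exp_comm_nn_integral[OF fin] by (simp add: nn_integral_add)
    finally show ?thesis .
  qed
  show ?thesis
  proof (rule ennreal_le_epsilon)
    fix e :: real assume fin: "c q + c r < \<top>" and e: "0 < e"
    have approx: "\<exists>P\<in>V m. exp_comm (mu_pow \<mu> m) P \<le> c m + ennreal (e / 2)" if "c m < \<top>" for m
    proof -
      \<comment> \<open>Finiteness of \<open>c m\<close> makes this strict, and a strict upper bound
        on an infimum is undercut by some protocol.\<close>
      have "c m + 0 < c m + ennreal (e / 2)"
        using that e by (subst ennreal_add_left_cancel_less) auto
      hence "c m < c m + ennreal (e / 2)" by simp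
      hence "(INF P\<in>V m. exp_comm (mu_pow \<mu> m) P) < c m + ennreal (e / 2)"
        by (simp only: c)
      thus ?thesis unfolding INF_less_iff by (auto intro: less_imp_le)
    qed
    have "c q < \<top>" "c r < \<top>" using fin by simp_all
    with approx obtain P Q where P: "P \<in> V q" "exp_comm (mu_pow \<mu> q) P \<le> c q + ennreal (e / 2)"
      and Q: "Q \<in> V r" "exp_comm (mu_pow \<mu> r) Q \<le> c r + ennreal (e / 2)"
      by meson
    note le[OF P(1) Q(1)]
    also have "exp_comm (mu_pow \<mu> q) P + exp_comm (mu_pow \<mu> r) Q \<le>
        (c q + ennreal (e / 2)) + (c r + ennreal (e / 2))"
      by (rule add_mono[OF P(2) Q(2)])
    also have "\<dots> = c q + c r + (ennreal (e / 2) + ennreal (e / 2))" by (simp add: algebra_simps)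
    also have "ennreal (e / 2) + ennreal (e / 2) = ennreal e" using e by (simp flip: ennreal_plus)
    finally show "c (q + r) \<le> c q + c r + ennreal e" .
  qed
qed

subsection \<open>Tensorization of the code length\<close>

text \<open>Kraft's inequality for prefix-free sets. Removing the first bit leaves two prefix-free
  sets of shorter strings, each entering with factor 1/2; the induction runs over a bound on the
  lengths.\<close>

lemma kraft:
  fixes S :: "bool list set"
  assumes "finite S" and pf: "\<And>s t. s \<in> S \<Longrightarrow> s @ t \<in> S \<Longrightarrow> t = []"
  shows "(\<Sum>s\<in>S. (1/2 :: real) ^ length s) \<le> 1"
proof -
  have "\<forall>s\<in>S. length s \<le> m \<Longrightarrow> (\<And>s t. s \<in> S \<Longrightarrow> s @ t \<in> S \<Longrightarrow> t = []) \<Longrightarrow> finite S \<Longrightarrow>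
    (\<Sum>s\<in>S. (1/2 :: real) ^ length s) \<le> 1" for m and S :: "bool list set"
  proof (induction m arbitrary: S)
    case 0
    hence "S \<subseteq> {[]}" by auto
    thus ?case by (auto simp: subset_singleton_iff)
  next
    case (Suc m)
    show ?case
    proof (cases "[] \<in> S")
      case True
      hence "S = {[]}" using Suc.prems(2)[of "[]"] by auto
      thus ?thesis by simp
    next
      case False
      define T where "T = (\<lambda>b. {s. b # s \<in> S})"
      have finT: "finite (T b)" for b
        using finite_vimageI[OF Suc.prems(3), of "(#) b"] by (simp add: T_def vimage_def)
      have le: "(\<Sum>s\<in>T b. (1/2 :: real) ^ length s) \<le> 1" for b
      proof (rule Suc.IH)
        show "\<forall>s\<in>T b. length s \<le> m" using Suc.prems(1) by (auto simp: T_def)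
        show "t = []" if "s \<in> T b" "s @ t \<in> T b" for s t
          using Suc.prems(2)[of "b # s" t] that by (auto simp: T_def)
      qed (rule finT)
      have "S = (#) True ` T True \<union> (#) False ` T False"
      proof (rule set_eqI)
        fix s show "s \<in> S \<longleftrightarrow> s \<in> (#) True ` T True \<union> (#) False ` T False"
          using False by (cases s; cases "hd s") (auto simp: T_def)
      qed
      hence "(\<Sum>s\<in>S. (1/2 :: real) ^ length s) =
        (\<Sum>s\<in>(#) True ` T True. (1/2) ^ length s) + (\<Sum>s\<in>(#) False ` T False. (1/2) ^ length s)"
        using finT by (auto intro!: sum.union_disjoint)
      also have "\<dots> = (1/2) * (\<Sum>s\<in>T True. (1/2) ^ length s) + (1/2) * (\<Sum>s\<in>T False. (1/2) ^ length s)"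
        by (simp add: sum.reindex sum_distrib_left o_def)
      also have "\<dots> \<le> 1" using le[of True] le[of False] by simp
      finally show ?thesis .
    qed
  qed
  from this[of S "Max (length ` S)"] assms show ?thesis by auto
qed

lemma measure_cond_pmf:
  assumes "set_pmf p \<inter> E \<noteq> {}"
  shows "measure (cond_pmf p E) F = measure p (E \<inter> F) / measure p E"
proof -
  have pos: "measure p E > 0" using assms by (meson disjoint_iff measure_pmf_posI)
  have "measure (cond_pmf p E) F = measure (uniform_measure p E) F"
    by (simp add: cond_pmf.rep_eq[OF assms])
  also have "\<dots> = measure p (E \<inter> F) / measure p E"
    using pos by (intro measure_uniform_measure) (auto simp: measure_pmf.emeasure_eq_measure)
  finally show ?thesis .
qed

text \<open>The ideal code length of \<open>z\<close> under the prior \<open>P\<close>, when any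
  object containing \<open>z\<close> may serve as its code word. The relation \<open>mem\<close> is
  a parameter so that single rectangles and lists of rectangles are treated alike.\<close>

definition code_len :: "('r \<Rightarrow> 'z \<Rightarrow> bool) \<Rightarrow> 'r pmf \<Rightarrow> 'z \<Rightarrow> real" where
  "code_len mem P z = - log 2 (measure P {R. mem R z})"

definition mem_list :: "('r \<Rightarrow> 'a \<times> 'b \<Rightarrow> bool) \<Rightarrow> 'r list \<Rightarrow> 'a list \<times> 'b list \<Rightarrow> bool" where
  "mem_list mem Rs z = list_all2 mem Rs (zip (fst z) (snd z))"

lemma expectation_mu_pow_Suc:
  fixes h :: "'a list \<times> 'b list \<Rightarrow> real"
  assumes "finite (set_pmf \<mu>)"
  shows "measure_pmf.expectation (mu_pow \<mu> (Suc q)) h =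
     measure_pmf.expectation \<mu> (\<lambda>z. measure_pmf.expectation (mu_pow \<mu> q) (\<lambda>zs. h (fst z # fst zs, snd z # snd zs)))"
proof -
  note fin = finite_mu_pow[OF assms, of q]
  have "mu_pow \<mu> (Suc q) = \<mu> \<bind> (\<lambda>z. map_pmf (\<lambda>zs. (fst z # fst zs, snd z # snd zs)) (mu_pow \<mu> q))"
    by (simp add: map_pmf_def case_prod_unfold)
  also have "measure_pmf.expectation \<dots> h = (\<Sum>z\<in>set_pmf \<mu>. pmf \<mu> z *
    measure_pmf.expectation (mu_pow \<mu> q) (\<lambda>zs. h (fst z # fst zs, snd z # snd zs)))"
    by (subst pmf_expectation_bind[OF assms]) (use fin in auto)
  also have "\<dots> = measure_pmf.expectation \<mu> (\<lambda>z. measure_pmf.expectation (mu_pow \<mu> q) (\<lambda>zs. h (fst z # fst zs, snd z # snd zs)))"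
    by (subst integral_measure_pmf[OF assms]) (auto simp: mult.commute)
  finally show ?thesis .
qed

text \<open>A chain rule for \<open>code_len\<close>. The coordinates under \<nu> may be correlated;
  conditioning on the event that the first rectangle contains the first input leaves a distribution
  to which the induction hypothesis applies. The covering hypotheses keep every measure under a
  logarithm positive.\<close>

lemma code_len_tensor:
  fixes mem :: "'r \<Rightarrow> 'a \<times> 'b \<Rightarrow> bool"
  assumes fin: "finite (set_pmf \<mu>)"
    and single: "\<And>P. set_pmf P \<subseteq> M \<Longrightarrow> (\<forall>z\<in>set_pmf \<mu>. \<exists>R\<in>set_pmf P. mem R z) \<Longrightarrow>
        K \<le> measure_pmf.expectation \<mu> (code_len mem P)"
  shows "(\<And>Rs. Rs \<in> set_pmf \<nu> \<Longrightarrow> length Rs = q \<and> set Rs \<subseteq> M) \<Longrightarrow>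
    (\<forall>zs\<in>set_pmf (mu_pow \<mu> q). \<exists>Rs\<in>set_pmf \<nu>. mem_list mem Rs zs) \<Longrightarrow>
    real q * K \<le> measure_pmf.expectation (mu_pow \<mu> q) (code_len (mem_list mem) \<nu>)"
proof (induction q arbitrary: \<nu>)
  case 0
  obtain Rs where "Rs \<in> set_pmf \<nu>" "mem_list mem Rs ([], [])" using "0.prems"(2) by auto
  hence "measure \<nu> {Rs. mem_list mem Rs ([], [])} > 0" by (intro measure_pmf_posI) auto
  hence "0 \<le> code_len (mem_list mem) \<nu> ([], [])" by (simp add: code_len_def)
  thus ?case by simp
next
  case (Suc q)
  \<comment> \<open>\<open>P\<close> is the law of the first rectangle, and \<open>\<nu>' z\<close>
    the law of the remaining ones given that the first contains \<open>z\<close>.\<close>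
  define P where "P = map_pmf hd \<nu>"
  define E where "E = (\<lambda>z. {Rs. mem (hd Rs) z})"
  define \<nu>' where "\<nu>' = (\<lambda>z. map_pmf tl (cond_pmf \<nu> (E z)))"
  have shape: "\<exists>R Rs'. Rs = R # Rs' \<and> length Rs' = q \<and> R \<in> M \<and> set Rs' \<subseteq> M" if "Rs \<in> set_pmf \<nu>" for Rs
    using Suc.prems(1)[OF that] by (cases Rs) auto
  have memc: "mem_list mem (R # Rs) (fst z # fst zs, snd z # snd zs) \<longleftrightarrow> mem R z \<and> mem_list mem Rs zs" for R Rs z zs
    by (simp add: mem_list_def)
  have zzs: "(fst z # fst zs, snd z # snd zs) \<in> set_pmf (mu_pow \<mu> (Suc q))" if "z \<in> set_pmf \<mu>" "zs \<in> set_pmf (mu_pow \<mu> q)" for z zs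
    using that by (auto simp: set_bind_pmf case_prod_unfold intro!: bexI[of _ z] bexI[of _ zs])
  obtain zs0 where zs0: "zs0 \<in> set_pmf (mu_pow \<mu> q)" using set_pmf_not_empty by fast
  have ex: "\<exists>R Rs. R # Rs \<in> set_pmf \<nu> \<and> mem R z \<and> mem_list mem Rs zs" if z_zs: "z \<in> set_pmf \<mu>" "zs \<in> set_pmf (mu_pow \<mu> q)" for z zs
  proof -
    obtain Rs where Rs: "Rs \<in> set_pmf \<nu>" "mem_list mem Rs (fst z # fst zs, snd z # snd zs)"
      using Suc.prems(2) zzs[OF z_zs] by blast
    with shape[OF Rs(1)] memc show ?thesis by blast
  qed
  have E: "set_pmf \<nu> \<inter> E z \<noteq> {}" if z: "z \<in> set_pmf \<mu>" for z
    using ex[OF z zs0] by (force simp: E_def)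
  \<comment> \<open>Joint mass equals mass of the first event times conditional mass of the rest;
    the negative logarithm turns this product into a sum.\<close>
  have factor: "code_len (mem_list mem) \<nu> (fst z # fst zs, snd z # snd zs) = code_len mem P z + code_len (mem_list mem) (\<nu>' z) zs"
    if z: "z \<in> set_pmf \<mu>" and zs: "zs \<in> set_pmf (mu_pow \<mu> q)" for z zs
  proof -
    let ?F = "{Rs. mem_list mem (tl Rs) zs}"
    have P: "measure P {R. mem R z} = measure \<nu> (E z)" by (simp add: P_def E_def vimage_def)
    have pos: "measure \<nu> (E z) > 0" using E[OF z] by (meson disjoint_iff measure_pmf_posI)
    have \<nu>': "measure (\<nu>' z) {Rs. mem_list mem Rs zs} = measure \<nu> (E z \<inter> ?F) / measure \<nu> (E z)"
      by (simp add: \<nu>'_def vimage_def measure_cond_pmf[OF E[OF z]])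
    have eq: "measure \<nu> {Rs. mem_list mem Rs (fst z # fst zs, snd z # snd zs)} = measure \<nu> (E z \<inter> ?F)"
    proof (rule measure_pmf.finite_measure_eq_AE)
      show "AE Rs in \<nu>. Rs \<in> {Rs. mem_list mem Rs (fst z # fst zs, snd z # snd zs)} \<longleftrightarrow> Rs \<in> E z \<inter> ?F"
      proof (rule AE_pmfI)
        fix Rs assume "Rs \<in> set_pmf \<nu>"
        from shape[OF this] show "Rs \<in> {Rs. mem_list mem Rs (fst z # fst zs, snd z # snd zs)} \<longleftrightarrow> Rs \<in> E z \<inter> ?F"
          by (auto simp: E_def memc)
      qed
    qed auto
    obtain R Rs where "R # Rs \<in> set_pmf \<nu>" "R # Rs \<in> E z \<inter> ?F" 
      using ex[OF z zs] by (auto simp: E_def)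
    hence pos2: "measure \<nu> (E z \<inter> ?F) > 0" by (meson measure_pmf_posI)
    show ?thesis using pos pos2 unfolding code_len_def P \<nu>' eq by (simp add: log_divide)
  qed
  have tail: "real q * K \<le> measure_pmf.expectation (mu_pow \<mu> q) (code_len (mem_list mem) (\<nu>' z))" if z: "z \<in> set_pmf \<mu>" for z
  proof (rule Suc.IH)
    have set: "set_pmf (\<nu>' z) = tl ` (set_pmf \<nu> \<inter> E z)" by (simp add: \<nu>'_def set_cond_pmf[OF E[OF z]])
    show "length Rs = q \<and> set Rs \<subseteq> M" if Rs: "Rs \<in> set_pmf (\<nu>' z)" for Rs
    proof -
      obtain Rs' where "Rs' \<in> set_pmf \<nu>" "Rs = tl Rs'" using Rs unfolding set by auto
      with shape[of Rs'] show ?thesis by auto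
    qed
    show "\<forall>zs\<in>set_pmf (mu_pow \<mu> q). \<exists>Rs\<in>set_pmf (\<nu>' z). mem_list mem Rs zs"
    proof
      fix zs assume "zs \<in> set_pmf (mu_pow \<mu> q)"
      from ex[OF z this] obtain R Rs where "R # Rs \<in> set_pmf \<nu> \<inter> E z" "mem_list mem Rs zs"
        by (auto simp: E_def)
      thus "\<exists>Rs\<in>set_pmf (\<nu>' z). mem_list mem Rs zs" unfolding set
        by (intro bexI[of _ Rs] image_eqI[of _ _ "R # Rs"]) auto
    qed
  qed
  have head: "K \<le> measure_pmf.expectation \<mu> (code_len mem P)"
  proof (rule single)
    show "set_pmf P \<subseteq> M"
    proof
      fix R assume "R \<in> set_pmf P"
      then obtain Rs where "Rs \<in> set_pmf \<nu>" "R = hd Rs" by (auto simp: P_def)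
      with shape[of Rs] show "R \<in> M" by auto
    qed
    show "\<forall>z\<in>set_pmf \<mu>. \<exists>R\<in>set_pmf P. mem R z"
    proof
      fix z assume "z \<in> set_pmf \<mu>"
      from E[OF this] show "\<exists>R\<in>set_pmf P. mem R z" by (auto simp: P_def E_def)
    qed
  qed
  note int = integrable_measure_pmf_finite[OF fin] integrable_measure_pmf_finite[OF finite_mu_pow[OF fin]]
  have "real (Suc q) * K = K + real q * K" by (simp add: algebra_simps)
  also have "\<dots> \<le> measure_pmf.expectation \<mu> (code_len mem P) + real q * K" using head by simp
  also have "\<dots> = measure_pmf.expectation \<mu> (\<lambda>z. code_len mem P z + real q * K)"
    by (simp add: int)
  also have "\<dots> \<le> measure_pmf.expectation \<mu> (\<lambda>z. code_len mem P z + measure_pmf.expectation (mu_pow \<mu> q) (code_len (mem_list mem) (\<nu>' z)))"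
    by (intro integral_mono_AE int AE_pmfI add_left_mono tail)
  also have "\<dots> = measure_pmf.expectation \<mu> (\<lambda>z. measure_pmf.expectation (mu_pow \<mu> q) 
       (\<lambda>zs. code_len mem P z + code_len (mem_list mem) (\<nu>' z) zs))"
    by (simp add: int)
  also have "\<dots> = measure_pmf.expectation \<mu> (\<lambda>z. measure_pmf.expectation (mu_pow \<mu> q) 
       (\<lambda>zs. code_len (mem_list mem) \<nu> (fst z # fst zs, snd z # snd zs)))"
    by (intro integral_cong_AE AE_pmfI factor[symmetric]) simp_all
  also have "\<dots> = measure_pmf.expectation (mu_pow \<mu> (Suc q)) (code_len (mem_list mem) \<nu>)"
    by (rule expectation_mu_pow_Suc[OF fin, symmetric])
  finally show ?case .
qed

subsection \<open>Lower bound on the expected communication\<close>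

text \<open>The weights are normalised by their total \<open>W\<close>. By Kraft \<open>W\<close> is
  at most 1, so the division can only raise them. The set may be infinite, in which case summability
  comes from the bounded finite sums.\<close>

lemma kraft_pmf:
  fixes S :: "bool list set"
  assumes "S \<noteq> {}" and pf: "\<And>s t. s \<in> S \<Longrightarrow> s @ t \<in> S \<Longrightarrow> t = []"
  shows "\<exists>p. set_pmf p = S \<and> (\<forall>s\<in>S. (1/2) ^ length s \<le> pmf p s)"
proof -
  let ?w = "\<lambda>s :: bool list. (1/2 :: real) ^ length s"
  have bound: "sum ?w F \<le> 1" if "finite F" "F \<subseteq> S" for F
    using that by (intro kraft) (auto dest: pf)
  have summ: "?w summable_on S"
    by (rule nonneg_bdd_above_summable_on) (auto intro!: bdd_aboveI[of _ 1] bound)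
  define W where "W = infsum ?w S"
  have W_le: "W \<le> 1" unfolding W_def by (rule infsum_le_finite_sums[OF summ bound])
  obtain s0 where s0: "s0 \<in> S" using assms(1) by auto
  have "sum ?w {s0} \<le> W" unfolding W_def
    by (rule finite_sum_le_infsum[OF summ]) (use s0 in auto)
  hence W_pos: "W > 0" by (rule less_le_trans[rotated]) simp
  define g where "g = (\<lambda>s. if s \<in> S then ?w s / W else 0)"
  have g_nonneg: "0 \<le> g s" for s using W_pos by (simp add: g_def)
  have "(?w has_sum W) S" using summ unfolding W_def by (rule has_sum_infsum)
  hence "((\<lambda>s. ?w s / W) has_sum W / W) S" unfolding divide_inverse by (rule has_sum_cmult_left)
  moreover have "(g has_sum W / W) UNIV \<longleftrightarrow> ((\<lambda>s. ?w s / W) has_sum W / W) S"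
    by (rule has_sum_cong_neutral) (auto simp: g_def)
  ultimately have "(g has_sum 1) UNIV" using W_pos by simp
  from nn_integral_count_space_has_sum[OF this g_nonneg]
  have int: "(\<integral>\<^sup>+ s. ennreal (g s) \<partial>count_space UNIV) = 1" by simp
  show ?thesis
  proof (intro exI conjI ballI)
    show "set_pmf (embed_pmf g) = S"
      using W_pos by (simp add: set_embed_pmf[OF g_nonneg int]) (auto simp: g_def)
    show "(1/2) ^ length s \<le> pmf (embed_pmf g) s" if "s \<in> S" for s
    proof -
      have "pmf (embed_pmf g) s = ?w s / W"
        unfolding pmf_embed_pmf[OF g_nonneg int] using that by (simp add: g_def)
      moreover have "?w s * W \<le> ?w s * 1" using W_le by (intro mult_left_mono) auto
      ultimately show ?thesis using W_pos by (simp add: pos_le_divide_eq)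
    qed
  qed
qed

text \<open>Jensen's inequality for the exponential: the expectation of
  \<open>(1/2) ^ length t\<close> under \<open>p\<close> is at most the mass of \<open>E\<close>
  under \<open>r\<close>, so the expected length is at least minus its logarithm. An infinite
  expected length makes the claim trivial.\<close>

lemma neg_log_le_expected_length:
  fixes p r :: "bool list pmf"
  assumes sub: "set_pmf p \<subseteq> E" and ge: "\<And>t. t \<in> set_pmf p \<Longrightarrow> (1/2) ^ length t \<le> pmf r t"
  shows "ennreal (- log 2 (measure r E)) \<le> (\<integral>\<^sup>+ t. ennreal (real (length t)) \<partial>p)"
proof (cases "(\<integral>\<^sup>+ t. ennreal (real (length t)) \<partial>p) = \<top>")
  case False
  define S where "S = measure r E"
  define a where "a = - log 2 S"
  let ?w = "\<lambda>t :: bool list. (1/2 :: real) ^ length t"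
  obtain t0 where t0: "t0 \<in> set_pmf p" using set_pmf_not_empty by fast
  have "0 < ?w t0" by simp
  also have "\<dots> \<le> pmf r t0" by (rule ge[OF t0])
  finally have "t0 \<in> set_pmf r" by (auto simp: set_pmf_iff)
  hence S: "S > 0" unfolding S_def using t0 sub by (intro measure_pmf_posI) auto
  have int: "integrable p (\<lambda>t. real (length t))"
    using False by (intro integrableI_bounded) (auto simp: less_top)
  have int_w: "integrable p ?w"
    by (rule measure_pmf.integrable_const_bound[where B = 1]) (auto simp: power_le_one)
  have "(\<integral>\<^sup>+ t. ennreal (?w t) \<partial>p) = (\<integral>\<^sup>+ t. ennreal (pmf p t) * ennreal (?w t) \<partial>count_space UNIV)"
    by (rule nn_integral_measure_pmf)
  also have "\<dots> \<le> (\<integral>\<^sup>+ t. ennreal (pmf r t) * indicator E t \<partial>count_space UNIV)"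
  proof (rule nn_integral_mono)
    fix t
    show "ennreal (pmf p t) * ennreal (?w t) \<le> ennreal (pmf r t) * indicator E t"
    proof (cases "t \<in> set_pmf p")
      case True
      \<comment> \<open>The crude bound \<open>pmf p t \<le> 1\<close> leaves the weight of
        \<open>t\<close>, which \<open>r\<close> dominates on the support of
        \<open>p\<close>.\<close>
      have "pmf p t * ?w t \<le> 1 * ?w t" by (rule mult_right_mono) (simp_all add: pmf_le_1)
      also have "\<dots> \<le> pmf r t" using ge[OF True] by simp
      finally have "ennreal (pmf p t * ?w t) \<le> ennreal (pmf r t)" by (rule ennreal_leI)
      thus ?thesis using True sub by (auto simp: ennreal_mult')
    qed (simp add: set_pmf_iff)
  qed
  also have "\<dots> = ennreal S"
    by (simp add: S_def nn_integral_measure_pmf[symmetric] measure_pmf.emeasure_eq_measure[symmetric])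
  finally have "(\<integral>\<^sup>+ t. ennreal (?w t) \<partial>p) \<le> ennreal S" .
  hence wS: "measure_pmf.expectation p ?w \<le> S"
    using S by (subst (asm) nn_integral_eq_integral[OF int_w]) auto
  \<comment> \<open>The tangent inequality \<open>1 + u \<le> exp u\<close> at
    \<open>u = (a - length t) * ln 2\<close>. After averaging, the correction term is nonnegative by
    \<open>wS\<close>.\<close>
  have pt: "a + (1 - ?w t / S) / ln 2 \<le> real (length t)" for t
  proof -
    have "(a - real (length t)) * ln 2 = - ln S + real (length t) * ln (1/2)"
      by (simp add: a_def log_def field_simps ln_div)
    hence "exp ((a - real (length t)) * ln 2) = ?w t / S"
      using S by (simp only: exp_add exp_minus exp_of_nat_mult) (simp add: field_simps)
    hence "1 + (a - real (length t)) * ln 2 \<le> ?w t / S" using exp_ge_add_one_self[of "(a - real (length t)) * ln 2"] by simp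
    thus ?thesis by (simp add: field_simps)
  qed
  have "a \<le> a + (1 - measure_pmf.expectation p ?w / S) / ln 2" using wS S by simp
  also have "\<dots> = measure_pmf.expectation p (\<lambda>t. a + (1 - ?w t / S) / ln 2)"
    using int_w by simp
  also have "\<dots> \<le> measure_pmf.expectation p (\<lambda>t. real (length t))"
    by (intro integral_mono pt int) (use int_w in simp)
  finally have "ennreal a \<le> ennreal (measure_pmf.expectation p (\<lambda>t. real (length t)))"
    by (rule ennreal_leI)
  also have "\<dots> = (\<integral>\<^sup>+ t. ennreal (real (length t)) \<partial>p)"
    by (rule nn_integral_eq_integral[OF int, symmetric]) simp
  finally show ?thesis by (simp add: a_def S_def)
qed simp

section \<open>Monochromatic rectangles obtained from transcripts\<close>

definition in_rect :: "'a set \<times> 'b set \<Rightarrow> 'a \<times> 'b \<Rightarrow> bool" where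
  "in_rect R z \<longleftrightarrow> fst z \<in> fst R \<and> snd z \<in> snd R"

definition mono_rects :: "'a set \<Rightarrow> 'b set \<Rightarrow> ('a \<Rightarrow> 'b \<Rightarrow> 'o) \<Rightarrow> ('a set \<times> 'b set) set" where
  "mono_rects A B f = {R. fst R \<subseteq> A \<and> snd R \<subseteq> B \<and> (\<exists>c. \<forall>x\<in>fst R. \<forall>y\<in>snd R. f x y = c)}"

text \<open>The rectangle property: each step depends on the input of one player only, so the inputs
  of two runs with the same transcript can be mixed.\<close>

lemma trans_prob_cross:
  assumes "trans_prob P x y t \<noteq> 0" "trans_prob P x' y' t \<noteq> 0"
  shows "trans_prob P x y' t \<noteq> 0"
proof -
  have "step_prob P x y' (take i t) (t ! i) \<noteq> 0" if "i < length t" for i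
    using trans_prob_not_haltedD(3)[OF assms(1) that] trans_prob_not_haltedD(3)[OF assms(2) that]
    by (auto simp: step_prob_def split: turn.splits)
  thus ?thesis using trans_prob_not_haltedD(1)[OF assms(1)] by (simp add: trans_prob_def)
qed

text \<open>The Kraft prior on possible transcripts is pushed forward to lists of projected
  rectangles. Tensorization bounds the average code length under this prior from below, and the cost
  of each input dominates its code length.\<close>

lemma exp_comm_lower:
  fixes P :: "(bool list list, bool list list, 'o list) protocol"
  assumes \<mu>: "set_pmf \<mu> \<subseteq> cube n \<times> cube n"
    and single: "\<And>Q. set_pmf Q \<subseteq> mono_rects (cube n) (cube n) f \<Longrightarrow>
        (\<forall>z\<in>set_pmf \<mu>. \<exists>R\<in>set_pmf Q. in_rect R z) \<Longrightarrow>
        K \<le> measure_pmf.expectation \<mu> (code_len in_rect Q)"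
    and valid: "valid_protocol P (cube_pow n q) (cube_pow n q)"
    and ze: "zero_error P (cube_pow n q) (cube_pow n q) (f_pow f)"
  shows "ennreal (real q * K) \<le> exp_comm (mu_pow \<mu> q) P"
proof -
  let ?D = "cube_pow n q"
  \<comment> \<open>\<open>T\<close> collects the transcripts possible on any input of the domain,
    not only on the support of the distribution. Zero error holds on the whole domain, so the full
    rectangle \<open>A t \<times> B t\<close> can be used.\<close>
  define T where "T = {t. \<exists>xs\<in>?D. \<exists>ys\<in>?D. trans_prob P xs ys t \<noteq> 0}"
  define A where "A = (\<lambda>t. {xs\<in>?D. \<exists>ys\<in>?D. trans_prob P xs ys t \<noteq> 0})"
  define B where "B = (\<lambda>t. {ys\<in>?D. \<exists>xs\<in>?D. trans_prob P xs ys t \<noteq> 0})"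
  define rect where "rect = (\<lambda>t. map (\<lambda>i. ((\<lambda>xs. xs ! i) ` A t, (\<lambda>ys. ys ! i) ` B t)) [0..<q])"
  have supp: "fst zs \<in> ?D" "snd zs \<in> ?D" if "zs \<in> set_pmf (mu_pow \<mu> q)" for zs
    using subsetD[OF set_mu_pow[OF \<mu>] that] by auto
  obtain zs0 where zs0: "zs0 \<in> set_pmf (mu_pow \<mu> q)" using set_pmf_not_empty by fast
  have set_tp: "set_pmf (trans_pmf P xs ys) \<subseteq> T" if "xs \<in> ?D" "ys \<in> ?D" for xs ys
    using that by (auto simp: set_trans_pmf[OF valid that] T_def)
  have T_ne: "T \<noteq> {}" using set_tp[OF supp[OF zs0]] set_pmf_not_empty by fast
  have T_pf: "t = []" if st: "s \<in> T" "s @ t \<in> T" for s t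
  proof (rule ccontr)
    assume "t \<noteq> []"
    obtain xs ys where "trans_prob P xs ys (s @ t) \<noteq> 0" using st by (auto simp: T_def)
    from trans_prob_not_haltedD(2)[OF this, of "length s"] \<open>t \<noteq> []\<close> have "turn P s \<noteq> HaltT" by simp
    moreover have "turn P s = HaltT" using st(1) trans_prob_not_haltedD(1) by (auto simp: T_def)
    ultimately show False by simp
  qed
  have "\<exists>r. set_pmf r = T \<and> (\<forall>t\<in>T. (1/2) ^ length t \<le> pmf r t)"
    using T_ne by (rule kraft_pmf) (rule T_pf)
  then obtain r where r: "set_pmf r = T" "\<And>t. t \<in> T \<Longrightarrow> (1/2) ^ length t \<le> pmf r t"
    by blast
  have mono: "set (rect t) \<subseteq> mono_rects (cube n) (cube n) f" for t
  proof -
    \<comment> \<open>Here \<open>xs\<close> and \<open>ys\<close> may come from different runs with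
      transcript \<open>t\<close>; crossing makes the pair itself possible, and the output depends
      on \<open>t\<close> alone, so its entry \<open>i\<close> is the colour of projection
      \<open>i\<close>.\<close>
    have "f (xs ! i) (ys ! i) = outp P t ! i" if "i < q" "xs \<in> A t" "ys \<in> B t" for i xs ys
    proof -
      from that(2,3) obtain ys' xs' where "trans_prob P xs ys' t \<noteq> 0" "trans_prob P xs' ys t \<noteq> 0"
        by (auto simp: A_def B_def)
      hence "trans_prob P xs ys t \<noteq> 0" by (rule trans_prob_cross)
      hence "outp P t = f_pow f xs ys" using ze that by (auto simp: zero_error_def A_def B_def)
      thus ?thesis using that by (simp add: f_pow_def A_def B_def cube_pow_def)
    qed
    moreover have "xs ! i \<in> cube n" if "i < q" "xs \<in> A t \<union> B t" for i xs
      using that by (auto simp: A_def B_def cube_pow_def cube_def)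
    ultimately show ?thesis by (fastforce simp: rect_def mono_rects_def)
  qed
  define \<nu> where "\<nu> = map_pmf rect r"
  have mem: "mem_list in_rect (rect t) (xs, ys)" if xy: "xs \<in> ?D" "ys \<in> ?D" and t: "t \<in> set_pmf (trans_pmf P xs ys)" for xs ys t
  proof -
    have "xs \<in> A t" "ys \<in> B t" using xy t by (auto simp: set_trans_pmf[OF valid xy] A_def B_def)
    moreover have "length xs = q" "length ys = q" using xy by (auto simp: cube_pow_def)
    ultimately show ?thesis
      by (auto simp: mem_list_def rect_def in_rect_def list_all2_conv_all_nth)
  qed
  have tensor: "real q * K \<le> measure_pmf.expectation (mu_pow \<mu> q) (code_len (mem_list in_rect) \<nu>)"
  proof (rule code_len_tensor[OF finite_subset[OF \<mu>] single])
    show "finite (cube n \<times> cube n)" using finite_cube by blast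
    show "length Rs = q \<and> set Rs \<subseteq> mono_rects (cube n) (cube n) f" if Rs: "Rs \<in> set_pmf \<nu>" for Rs
    proof -
      from Rs obtain t where "Rs = rect t" by (auto simp: \<nu>_def)
      thus ?thesis using mono by (auto simp: rect_def)
    qed
    show "\<forall>zs\<in>set_pmf (mu_pow \<mu> q). \<exists>Rs\<in>set_pmf \<nu>. mem_list in_rect Rs zs"
    proof
      fix zs assume zs: "zs \<in> set_pmf (mu_pow \<mu> q)"
      obtain t where t: "t \<in> set_pmf (trans_pmf P (fst zs) (snd zs))" using set_pmf_not_empty by fast
      from mem[OF supp[OF zs] t] subsetD[OF set_tp[OF supp[OF zs]] t]
      show "\<exists>Rs\<in>set_pmf \<nu>. mem_list in_rect Rs zs" by (auto simp: \<nu>_def r(1))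
    qed
  qed
  \<comment> \<open>Every transcript possible on \<open>zs\<close> yields a list of rectangles
    containing \<open>zs\<close>, so the transcript distribution lives inside the event measured by
    \<open>code_len\<close>.\<close>
  have pt: "ennreal (code_len (mem_list in_rect) \<nu> zs) \<le> cost P (fst zs) (snd zs)" if zs: "zs \<in> set_pmf (mu_pow \<mu> q)" for zs
    unfolding cost_trans_pmf[OF valid supp[OF zs]] code_len_def \<nu>_def measure_map_pmf
  proof (rule neg_log_le_expected_length)
    show "set_pmf (trans_pmf P (fst zs) (snd zs)) \<subseteq> rect -` {R. mem_list in_rect R zs}"
      using mem[OF supp[OF zs]] by auto
    show "(1/2) ^ length t \<le> pmf r t" if "t \<in> set_pmf (trans_pmf P (fst zs) (snd zs))" for t
      using r(2) subsetD[OF set_tp[OF supp[OF zs]] that] .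
  qed
  have nonneg: "0 \<le> code_len (mem_list in_rect) \<nu> zs" if zs: "zs \<in> set_pmf (mu_pow \<mu> q)" for zs
  proof -
    obtain t where t: "t \<in> set_pmf (trans_pmf P (fst zs) (snd zs))" using set_pmf_not_empty by fast
    have "rect t \<in> set_pmf \<nu>" using subsetD[OF set_tp[OF supp[OF zs]] t] by (simp add: \<nu>_def r(1))
    hence "measure \<nu> {Rs. mem_list in_rect Rs zs} > 0"
      using mem[OF supp[OF zs] t] by (intro measure_pmf_posI) auto
    thus ?thesis by (simp add: code_len_def)
  qed
  note fin = finite_mu_pow[OF finite_subset[OF \<mu> finite_cartesian_product[OF finite_cube finite_cube]]]
  have "ennreal (real q * K) \<le> ennreal (measure_pmf.expectation (mu_pow \<mu> q) (code_len (mem_list in_rect) \<nu>))"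
    using tensor by (rule ennreal_leI)
  also have "\<dots> = (\<integral>\<^sup>+ zs. ennreal (code_len (mem_list in_rect) \<nu> zs) \<partial>mu_pow \<mu> q)"
    by (rule nn_integral_eq_integral[symmetric]) (auto intro!: integrable_measure_pmf_finite fin AE_pmfI nonneg)
  also have "\<dots> \<le> (\<integral>\<^sup>+ zs. cost P (fst zs) (snd zs) \<partial>mu_pow \<mu> q)"
    by (intro nn_integral_mono_AE AE_pmfI pt)
  also have "\<dots> = exp_comm (mu_pow \<mu> q) P" by (rule exp_comm_nn_integral[OF fin, symmetric])
  finally show ?thesis .
qed

subsection \<open>Finite protocol trees\<close>

text \<open>A node holds the speaker (\<open>True\<close> for Alice), the probability of sending
  \<open>True\<close> given the speaker's input, and the probability of \<open>True\<close> in the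
  eyes of an observer who knows no input. The last one provides the reference distribution for
  bounding information. Both players share the input type, so one function serves either
  speaker.\<close>

datatype ('i, 'o) ptree = Leaf 'o | Node bool "'i \<Rightarrow> real" real "('i, 'o) ptree" "('i, 'o) ptree"

definition own :: "bool \<Rightarrow> 'i \<Rightarrow> 'i \<Rightarrow> 'i" where
  "own s x y = (if s then x else y)"

text \<open>Strings running past a leaf stay at that leaf. They count as halting nodes but have
  probability 0, since a step out of a halting node has probability 0.\<close>

fun subtree :: "('i, 'o) ptree \<Rightarrow> bool list \<Rightarrow> ('i, 'o) ptree" where
  "subtree T [] = T"
| "subtree (Leaf v) (b # h) = Leaf v"
| "subtree (Node s p r T F) (b # h) = subtree (if b then T else F) h"

definition tree_protocol :: "('i, 'o) ptree \<Rightarrow> ('i, 'i, 'o) protocol" where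
  "tree_protocol T = \<lparr>
     turn = (\<lambda>h. case subtree T h of Leaf _ \<Rightarrow> HaltT | Node s _ _ _ _ \<Rightarrow> if s then AliceT else BobT),
     pA = (\<lambda>x h. case subtree T h of Leaf _ \<Rightarrow> 0 | Node _ p _ _ _ \<Rightarrow> p x),
     pB = (\<lambda>y h. case subtree T h of Leaf _ \<Rightarrow> 0 | Node _ p _ _ _ \<Rightarrow> p y),
     outp = (\<lambda>h. case subtree T h of Leaf v \<Rightarrow> v | Node _ _ _ _ _ \<Rightarrow> undefined)\<rparr>"

fun wf_tree :: "('i, 'o) ptree \<Rightarrow> bool" where
  "wf_tree (Leaf v) \<longleftrightarrow> True"
| "wf_tree (Node s p r T F) \<longleftrightarrow> (\<forall>x. 0 \<le> p x \<and> p x \<le> 1) \<and> 0 \<le> r \<and> r \<le> 1 \<and> wf_tree T \<and> wf_tree F"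

fun leaves :: "('i, 'o) ptree \<Rightarrow> bool list set" where
  "leaves (Leaf v) = {[]}"
| "leaves (Node s p r T F) = (#) True ` leaves T \<union> (#) False ` leaves F"

fun leaf_prob :: "('i, 'o) ptree \<Rightarrow> 'i \<Rightarrow> 'i \<Rightarrow> bool list \<Rightarrow> real" where
  "leaf_prob (Leaf v) x y t = (if t = [] then 1 else 0)"
| "leaf_prob (Node s p r T F) x y [] = 0"
| "leaf_prob (Node s p r T F) x y (b # t) =
     (if b then p (own s x y) * leaf_prob T x y t else (1 - p (own s x y)) * leaf_prob F x y t)"

fun leaf_prior :: "('i, 'o) ptree \<Rightarrow> bool list \<Rightarrow> real" where
  "leaf_prior (Leaf v) t = (if t = [] then 1 else 0)"
| "leaf_prior (Node s p r T F) [] = 0"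
| "leaf_prior (Node s p r T F) (b # t) = (if b then r * leaf_prior T t else (1 - r) * leaf_prior F t)"

text \<open>The relative entropy of \<open>leaf_prob\<close> with respect to
  \<open>leaf_prior\<close>, unfolded node by node with the chain rule.\<close>

fun divergence :: "('i, 'o) ptree \<Rightarrow> 'i \<Rightarrow> 'i \<Rightarrow> real" where
  "divergence (Leaf v) x y = 0"
| "divergence (Node s p r T F) x y = (let q = p (own s x y) in
     q * (log 2 (q / r) + divergence T x y) + (1 - q) * (log 2 ((1 - q) / (1 - r)) + divergence F x y))"

text \<open>Absolute continuity with respect to the prior: it guards the quotients and logarithms in
  \<open>divergence\<close> along every branch the input can take.\<close>

fun abs_cont :: "('i, 'o) ptree \<Rightarrow> 'i \<Rightarrow> 'i \<Rightarrow> bool" where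
  "abs_cont (Leaf v) x y \<longleftrightarrow> True"
| "abs_cont (Node s p r T F) x y \<longleftrightarrow> (p (own s x y) \<noteq> 0 \<longrightarrow> 0 < r \<and> abs_cont T x y) \<and>
     (p (own s x y) \<noteq> 1 \<longrightarrow> r < 1 \<and> abs_cont F x y)"

fun outs :: "('i, 'o) ptree \<Rightarrow> 'i \<Rightarrow> 'i \<Rightarrow> 'o set" where
  "outs (Leaf v) x y = {v}"
| "outs (Node s p r T F) x y = (if p (own s x y) \<noteq> 0 then outs T x y else {}) \<union>
     (if p (own s x y) \<noteq> 1 then outs F x y else {})"

lemma finite_leaves [simp]: "finite (leaves T)"
  by (induction T) auto

lemma sum_leaves_Node:
  fixes g :: "bool list \<Rightarrow> real"
  shows "sum g (leaves (Node s p r T F)) = (\<Sum>t\<in>leaves T. g (True # t)) + (\<Sum>t\<in>leaves F. g (False # t))"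
proof -
  have "sum g (leaves (Node s p r T F)) = sum g ((#) True ` leaves T) + sum g ((#) False ` leaves F)"
    unfolding leaves.simps by (rule sum.union_disjoint) auto
  thus ?thesis by (simp add: sum.reindex)
qed

lemma subtree_Leaf [simp]: "subtree (Leaf v) h = Leaf v"
  by (cases h) auto

lemma trans_prob_tree: "trans_prob (tree_protocol T) x y t = leaf_prob T x y t"
proof (induction T arbitrary: t)
  case (Leaf v)
  show ?case
    by (cases t) (auto simp: trans_prob_def tree_protocol_def step_prob_def)
next
  case (Node s p r T F)
  show ?case
  proof (cases t)
    case Nil
    thus ?thesis by (auto simp: trans_prob_def tree_protocol_def)
  next
    case (Cons b u)
    let ?S = "if b then T else F"
    have turn: "turn (tree_protocol (Node s p r T F)) (b # h) = turn (tree_protocol ?S) h" for h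
      by (simp add: tree_protocol_def)
    have step: "step_prob (tree_protocol (Node s p r T F)) x y (b # h) c = step_prob (tree_protocol ?S) x y h c" for h c
      by (auto simp: step_prob_def tree_protocol_def split: turn.split)
    have "trans_prob (tree_protocol (Node s p r T F)) x y (b # u) =
       step_prob (tree_protocol (Node s p r T F)) x y [] b * trans_prob (tree_protocol ?S) x y u"
      unfolding trans_prob_def turn by (simp add: prod.lessThan_Suc_shift step del: prod.lessThan_Suc)
    also have "step_prob (tree_protocol (Node s p r T F)) x y [] b = 
       (if b then p (own s x y) else 1 - p (own s x y))"
      by (simp add: step_prob_def tree_protocol_def own_def)
    finally show ?thesis using Node.IH Cons by simp
  qed
qed

lemma leaf_prob_nonneg: "wf_tree T \<Longrightarrow> 0 \<le> leaf_prob T x y t"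
  by (induction T x y t rule: leaf_prob.induct) auto

lemma leaf_prior_nonneg: "wf_tree T \<Longrightarrow> 0 \<le> leaf_prior T t"
  by (induction T t rule: leaf_prior.induct) auto

lemma leaf_prob_outside: "t \<notin> leaves T \<Longrightarrow> leaf_prob T x y t = 0"
  by (induction T x y t rule: leaf_prob.induct) (auto split: if_splits)

lemma sum_leaf_prob: "(\<Sum>t\<in>leaves T. leaf_prob T x y t) = 1"
  by (induction T) (simp_all add: sum_leaves_Node sum_distrib_left[symmetric] del: leaves.simps(2))

lemma sum_leaf_prior: "(\<Sum>t\<in>leaves T. leaf_prior T t) = 1"
  by (induction T) (simp_all add: sum_leaves_Node sum_distrib_left[symmetric] del: leaves.simps(2))

lemma leaf_prior_pos: 
  "wf_tree T \<Longrightarrow> abs_cont T x y \<Longrightarrow> leaf_prob T x y t \<noteq> 0 \<Longrightarrow> 0 < leaf_prior T t"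
  by (induction T x y t rule: leaf_prob.induct) (auto split: if_splits)

lemma outp_tree: "leaf_prob T x y t \<noteq> 0 \<Longrightarrow> outp (tree_protocol T) t \<in> outs T x y"
  by (induction T x y t rule: leaf_prob.induct) (auto simp: tree_protocol_def split: if_splits)

text \<open>The chain rule for relative entropy: below each child the logarithm of the product of
  ratios splits, and the leaf probabilities of the subtree sum to 1. Leaves of probability 0
  contribute nothing.\<close>

lemma divergence_eq:
  assumes "wf_tree T" "abs_cont T x y"
  shows "(\<Sum>t\<in>leaves T. leaf_prob T x y t * log 2 (leaf_prob T x y t / leaf_prior T t)) = divergence T x y"
  using assms
proof (induction T)
  case (Leaf v)
  show ?case by simp
next
  case (Node s p r T F)
  define q where "q = p (own s x y)"
  have half: "(\<Sum>t\<in>leaves S. a * leaf_prob S x y t * log 2 (a * leaf_prob S x y t / (b * leaf_prior S t))) =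
      a * (log 2 (a / b) + divergence S x y)"
    if S: "a \<noteq> 0 \<Longrightarrow> 0 < b \<and> abs_cont S x y" "wf_tree S" "0 \<le> a" 
      "a \<noteq> 0 \<Longrightarrow> (\<Sum>t\<in>leaves S. leaf_prob S x y t * log 2 (leaf_prob S x y t / leaf_prior S t)) = divergence S x y"
    for a b and S :: "('a, 'b) ptree"
  proof (cases "a = 0")
    case False
    have "(\<Sum>t\<in>leaves S. a * leaf_prob S x y t * log 2 (a * leaf_prob S x y t / (b * leaf_prior S t))) =
      (\<Sum>t\<in>leaves S. a * log 2 (a / b) * leaf_prob S x y t + a * (leaf_prob S x y t * log 2 (leaf_prob S x y t / leaf_prior S t)))"
    proof (rule sum.cong[OF refl])
      fix t
      show "a * leaf_prob S x y t * log 2 (a * leaf_prob S x y t / (b * leaf_prior S t)) =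
         a * log 2 (a / b) * leaf_prob S x y t + a * (leaf_prob S x y t * log 2 (leaf_prob S x y t / leaf_prior S t))"
      proof (cases "leaf_prob S x y t = 0")
        case nz: False
        have "0 < leaf_prior S t" using leaf_prior_pos[OF S(2) _ nz] S(1) False by simp
        moreover have "0 < leaf_prob S x y t" using leaf_prob_nonneg[OF S(2), of x y t] nz by simp
        ultimately have "log 2 (a * leaf_prob S x y t / (b * leaf_prior S t)) =
           log 2 (a / b) + log 2 (leaf_prob S x y t / leaf_prior S t)"
          using S False by (simp add: log_mult log_divide)
        thus ?thesis by (simp add: algebra_simps)
      qed simp
    qed
    also have "\<dots> = a * log 2 (a / b) * 1 + a * divergence S x y"
      unfolding sum.distrib sum_distrib_left[symmetric] sum_leaf_prob using S(4)[OF False] by simp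
    finally show ?thesis by (simp add: algebra_simps)
  qed simp
  have q: "0 \<le> q" "q \<le> 1" using Node.prems(1) by (auto simp: q_def)
  have "q * (log 2 (q / r) + divergence T x y) = 
      (\<Sum>t\<in>leaves T. q * leaf_prob T x y t * log 2 (q * leaf_prob T x y t / (r * leaf_prior T t)))"
    using Node q by (intro half[symmetric]) (auto simp: q_def)
  moreover have "(1 - q) * (log 2 ((1 - q) / (1 - r)) + divergence F x y) = 
      (\<Sum>t\<in>leaves F. (1 - q) * leaf_prob F x y t * log 2 ((1 - q) * leaf_prob F x y t / ((1 - r) * leaf_prior F t)))"
    using Node q by (intro half[symmetric]) (auto simp: q_def)
  ultimately show ?case
    by (simp add: sum_leaves_Node Let_def q_def[symmetric] del: leaves.simps(2))
qed

lemma valid_tree: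
  assumes "wf_tree T"
  shows "valid_protocol (tree_protocol T) A B"
  unfolding valid_protocol_def
proof (intro conjI ballI)
  have *: "0 \<le> (case subtree T h of Leaf _ \<Rightarrow> 0 | Node _ p _ _ _ \<Rightarrow> p x) \<and>
      (case subtree T h of Leaf _ \<Rightarrow> 0 | Node _ p _ _ _ \<Rightarrow> p x) \<le> (1::real)" for x h
    using assms by (induction T h rule: subtree.induct) (auto split: ptree.splits)
  thus "\<forall>x h. 0 \<le> pA (tree_protocol T) x h \<and> pA (tree_protocol T) x h \<le> 1"
    "\<forall>y h. 0 \<le> pB (tree_protocol T) y h \<and> pB (tree_protocol T) y h \<le> 1"
    by (auto simp: tree_protocol_def)
  show "(trans_prob (tree_protocol T) x y has_sum 1) UNIV" for x y
    by (rule has_sum_finite_neutralI[of "leaves T"])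
       (auto simp: trans_prob_tree sum_leaf_prob leaf_prob_outside)
qed

lemma cost_tree_finite:
  assumes "wf_tree T"
  shows "cost (tree_protocol T) x y < \<top>"
proof -
  note v = valid_tree[OF assms, of UNIV UNIV]
  have "set_pmf (trans_pmf (tree_protocol T) x y) \<subseteq> leaves T"
    using set_trans_pmf[OF v, of x y] leaf_prob_outside[of _ T x y] by (auto simp: trans_prob_tree)
  hence fin: "finite (set_pmf (trans_pmf (tree_protocol T) x y))" by (rule finite_subset) simp
  show ?thesis unfolding cost_trans_pmf[OF v UNIV_I UNIV_I]
    by (subst nn_integral_measure_pmf_finite[OF fin]) (simp_all add: sum_ennreal flip: ennreal_mult)
qed

section \<open>External information and error of finite trees\<close>

lemma sum_pmf_set: "finite (set_pmf p) \<Longrightarrow> (\<Sum>z\<in>set_pmf p. pmf p z) = 1"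
  by (rule sum_pmf_eq_1) auto

text \<open>Holds transcript by transcript through \<open>ln u \<le> u - 1\<close>, whose linear
  terms cancel when averaged over the inputs. It bounds from below the set whose infimum defines
  \<open>IC_ext\<close>.\<close>

lemma ext_info_nonneg:
  fixes P :: "('a, 'b, 'o) protocol"
  assumes fin: "finite (set_pmf \<mu>)" and v: "valid_protocol P A B"
  shows "0 \<le> ext_info \<mu> P"
  unfolding ext_info_def
proof (rule infsum_nonneg)
  fix t
  define m where "m = trans_marg \<mu> P t"
  define a where "a = (\<lambda>z. pmf \<mu> z * trans_prob P (fst z) (snd z) t)"
  have m: "m = (\<Sum>z\<in>set_pmf \<mu>. a z)" by (simp add: m_def trans_marg_def a_def case_prod_unfold)
  have a_nonneg: "0 \<le> a z" for z using trans_prob_nonneg[OF v] by (simp add: a_def)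
  have "(a z - pmf \<mu> z * m) / ln 2 \<le> a z * log 2 (trans_prob P (fst z) (snd z) t / m)" if z: "z \<in> set_pmf \<mu>" for z
  proof (cases "a z = 0")
    case True
    thus ?thesis using sum_nonneg[of "set_pmf \<mu>" a] a_nonneg by (simp add: m)
  next
    case False
    let ?p = "trans_prob P (fst z) (snd z) t"
    have p: "?p > 0" using False trans_prob_nonneg[OF v, of "fst z" "snd z" t] by (auto simp: a_def order.order_iff_strict)
    have "a z \<le> m" unfolding m by (rule member_le_sum[OF z]) (use a_nonneg fin in auto)
    hence m_pos: "m > 0" using False a_nonneg[of z] by simp
    have "ln (m / ?p) \<le> m / ?p - 1" using m_pos p by (intro ln_le_minus_one) simp
    hence "1 - m / ?p \<le> ln (?p / m)" using m_pos p by (simp add: ln_div)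
    hence "a z * (1 - m / ?p) \<le> a z * ln (?p / m)" by (rule mult_left_mono) (rule a_nonneg)
    moreover have "a z * (1 - m / ?p) = a z - pmf \<mu> z * m" using p by (simp add: a_def field_simps)
    ultimately have "(a z - pmf \<mu> z * m) / ln 2 \<le> a z * ln (?p / m) / ln 2" by (simp add: divide_right_mono)
    thus ?thesis by (simp add: log_def)
  qed
  hence "(\<Sum>z\<in>set_pmf \<mu>. (a z - pmf \<mu> z * m) / ln 2) \<le> (\<Sum>z\<in>set_pmf \<mu>. a z * log 2 (trans_prob P (fst z) (snd z) t / m))"
    by (rule sum_mono)
  moreover have "(\<Sum>z\<in>set_pmf \<mu>. (a z - pmf \<mu> z * m) / ln 2) = 0"
    using sum_pmf_set[OF fin] by (simp add: sum_divide_distrib[symmetric] sum_subtractf m[symmetric] sum_distrib_right[symmetric])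
  ultimately show "0 \<le> (\<Sum>(x, y)\<in>set_pmf \<mu>. pmf \<mu> (x, y) * trans_prob P x y t *
       log 2 (trans_prob P x y t / trans_marg \<mu> P t))"
    by (simp add: a_def m_def case_prod_unfold)
qed

text \<open>Mutual information is at most the average divergence from any fixed reference
  distribution, here \<open>leaf_prior\<close>. A divergence bound for each single input therefore
  suffices.\<close>

lemma ext_info_tree_le:
  assumes fin: "finite (set_pmf \<mu>)" and wf: "wf_tree T"
    and ac: "\<And>z. z \<in> set_pmf \<mu> \<Longrightarrow> abs_cont T (fst z) (snd z)"
    and D: "\<And>z. z \<in> set_pmf \<mu> \<Longrightarrow> divergence T (fst z) (snd z) \<le> D"
  shows "ext_info \<mu> (tree_protocol T) \<le> D"
proof -
  let ?p = "\<lambda>z t. leaf_prob T (fst z) (snd z) t"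
  define m where "m = (\<lambda>t. \<Sum>z\<in>set_pmf \<mu>. pmf \<mu> z * ?p z t)"
  have m: "trans_marg \<mu> (tree_protocol T) t = m t" for t
    by (simp add: trans_marg_def m_def trans_prob_tree case_prod_unfold)
  have p_nonneg: "0 \<le> ?p z t" for z t by (rule leaf_prob_nonneg[OF wf])
  have sum_m: "(\<Sum>t\<in>leaves T. m t) = 1"
    unfolding m_def by (subst sum.swap) (simp add: sum_distrib_left[symmetric] sum_leaf_prob sum_pmf_set[OF fin])
  have "ext_info \<mu> (tree_protocol T) = (\<Sum>t\<in>leaves T. \<Sum>z\<in>set_pmf \<mu>. pmf \<mu> z * ?p z t * log 2 (?p z t / m t))"
    unfolding ext_info_def m trans_prob_tree case_prod_unfold prod.collapse
    by (rule infsumI, rule has_sum_finite_neutralI[of "leaves T"]) (auto simp: leaf_prob_outside)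
  also have "\<dots> \<le> (\<Sum>t\<in>leaves T. (\<Sum>z\<in>set_pmf \<mu>. pmf \<mu> z * ?p z t * log 2 (?p z t / leaf_prior T t)) + (leaf_prior T t - m t) / ln 2)"
  proof (rule sum_mono)
    fix t
    let ?r = "leaf_prior T t"
    have "pmf \<mu> z * ?p z t * log 2 (?p z t / m t) \<le> pmf \<mu> z * ?p z t * log 2 (?p z t / ?r) + pmf \<mu> z * ?p z t * ((?r / m t - 1) / ln 2)"
      if z: "z \<in> set_pmf \<mu>" for z
    proof (cases "?p z t = 0")
      case False
      hence p: "?p z t > 0" using p_nonneg[of z t] by simp
      have r: "?r > 0" by (rule leaf_prior_pos[OF wf ac[OF z] False])
      have "0 < pmf \<mu> z * ?p z t" using p z by (simp add: pmf_positive)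
      also have "\<dots> \<le> m t" unfolding m_def by (rule member_le_sum[OF z]) (use fin p_nonneg in auto)
      finally have mt: "m t > 0" .
      have "log 2 (?p z t / m t) = log 2 (?p z t / ?r) + ln (?r / m t) / ln 2"
        using p r mt by (simp add: log_divide log_def ln_div diff_divide_distrib)
      \<comment> \<open>Linearising the logarithm replaces the gap between marginal and prior by a
        difference of their masses, which sums to 0 over the leaves.\<close>
      also have "ln (?r / m t) / ln 2 \<le> (?r / m t - 1) / ln 2"
        using r mt by (intro divide_right_mono ln_le_minus_one) auto
      finally have "log 2 (?p z t / m t) \<le> log 2 (?p z t / ?r) + (?r / m t - 1) / ln 2" by simp
      from mult_left_mono[OF this, of "pmf \<mu> z * ?p z t"] p show ?thesis by (simp add: distrib_left)
    qed simp
    hence "(\<Sum>z\<in>set_pmf \<mu>. pmf \<mu> z * ?p z t * log 2 (?p z t / m t)) \<le>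
      (\<Sum>z\<in>set_pmf \<mu>. pmf \<mu> z * ?p z t * log 2 (?p z t / ?r) + pmf \<mu> z * ?p z t * ((?r / m t - 1) / ln 2))"
      by (rule sum_mono)
    also have "\<dots> = (\<Sum>z\<in>set_pmf \<mu>. pmf \<mu> z * ?p z t * log 2 (?p z t / ?r)) + m t * ((?r / m t - 1) / ln 2)"
      unfolding sum.distrib sum_distrib_right[symmetric] m_def ..
    also have "m t * ((?r / m t - 1) / ln 2) \<le> (?r - m t) / ln 2"
      using leaf_prior_nonneg[OF wf, of t] by (cases "m t = 0") (simp_all add: field_simps)
    finally show "(\<Sum>z\<in>set_pmf \<mu>. pmf \<mu> z * ?p z t * log 2 (?p z t / m t)) \<le> 
      (\<Sum>z\<in>set_pmf \<mu>. pmf \<mu> z * ?p z t * log 2 (?p z t / ?r)) + (?r - m t) / ln 2" by simp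
  qed
  also have "\<dots> = (\<Sum>t\<in>leaves T. \<Sum>z\<in>set_pmf \<mu>. pmf \<mu> z * (?p z t * log 2 (?p z t / leaf_prior T t)))"
    by (simp add: sum.distrib sum_divide_distrib[symmetric] sum_subtractf sum_m sum_leaf_prior mult.assoc)
  also have "\<dots> = (\<Sum>z\<in>set_pmf \<mu>. pmf \<mu> z * divergence T (fst z) (snd z))"
    by (subst sum.swap) (simp add: sum_distrib_left[symmetric] divergence_eq[OF wf ac])
  also have "\<dots> \<le> (\<Sum>z\<in>set_pmf \<mu>. pmf \<mu> z * D)"
    by (intro sum_mono mult_left_mono D) auto
  also have "\<dots> = D" by (simp add: sum_distrib_right[symmetric] sum_pmf_set[OF fin])
  finally show ?thesis .
qed

text \<open>Inputs outside \<open>Bad\<close> can reach only correct leaves; for the others the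
  error is bounded by 1.\<close>

lemma error_prob_tree_le:
  assumes fin: "finite (set_pmf \<mu>)" and wf: "wf_tree T"
    and good: "\<And>z. z \<in> set_pmf \<mu> \<Longrightarrow> z \<notin> Bad \<Longrightarrow> outs T (fst z) (snd z) \<subseteq> {f (fst z) (snd z)}"
  shows "error_prob \<mu> (tree_protocol T) f \<le> measure \<mu> Bad"
proof -
  let ?e = "\<lambda>z. infsum (\<lambda>t. if outp (tree_protocol T) t \<noteq> f (fst z) (snd z) then leaf_prob T (fst z) (snd z) t else 0) UNIV"
  have "pmf \<mu> z * ?e z \<le> pmf \<mu> z * indicator Bad z" if z: "z \<in> set_pmf \<mu>" for z
  proof (rule mult_left_mono)
    have sum: "?e z = (\<Sum>t\<in>leaves T. if outp (tree_protocol T) t \<noteq> f (fst z) (snd z) then leaf_prob T (fst z) (snd z) t else 0)"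
      by (rule infsumI, rule has_sum_finite_neutralI[of "leaves T"]) (auto simp: leaf_prob_outside)
    show "?e z \<le> indicator Bad z"
    proof (cases "z \<in> Bad")
      case True
      have "?e z \<le> (\<Sum>t\<in>leaves T. leaf_prob T (fst z) (snd z) t)"
        unfolding sum by (rule sum_mono) (simp add: leaf_prob_nonneg[OF wf])
      thus ?thesis using True by (simp add: sum_leaf_prob)
    next
      case False
      have "(if outp (tree_protocol T) t \<noteq> f (fst z) (snd z) then leaf_prob T (fst z) (snd z) t else 0) = 0" for t
        using outp_tree[of T "fst z" "snd z" t] good[OF z False] by auto
      thus ?thesis unfolding sum by (simp only: sum.neutral_const) simp
    qed
  qed simp
  hence "error_prob \<mu> (tree_protocol T) f \<le> (\<Sum>z\<in>set_pmf \<mu>. pmf \<mu> z * indicator Bad z)"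
    unfolding error_prob_def trans_prob_tree case_prod_unfold prod.collapse by (rule sum_mono)
  also have "\<dots> = measure_pmf.expectation \<mu> (indicator Bad)"
    by (subst integral_measure_pmf[OF fin]) (auto simp: mult.commute)
  finally show ?thesis by simp
qed

subsection \<open>Sending an element of a list\<close>

text \<open>The list is walked through with one bit per element, each answering whether this element
  is the chosen one. The conditional probabilities are set so that a speaker with input
  \<open>x\<close> chooses an element of \<open>U x\<close> with probability proportional to its
  weight, while the prior chooses from the whole list. The end of the list is unreachable when
  \<open>U x\<close> has positive weight in it.\<close>

fun send :: "bool \<Rightarrow> ('r \<Rightarrow> real) \<Rightarrow> ('i \<Rightarrow> 'r set) \<Rightarrow> ('r \<Rightarrow> ('i, 'o) ptree) \<Rightarrow> 'r list \<Rightarrow> ('i, 'o) ptree" where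
  "send s w U g [] = Leaf undefined"
| "send s w U g (i # l) = Node s
     (\<lambda>x. indicator (U x) i * w i / (\<Sum>j\<leftarrow>i # l. indicator (U x) j * w j))
     (w i / (\<Sum>j\<leftarrow>i # l. w j)) (g i) (send s w U g l)"

lemma fraction_bounds:
  fixes a b :: real
  assumes "0 \<le> a" "0 \<le> b"
  shows "0 \<le> a / (a + b)" "a / (a + b) \<le> 1"
  using assms by (auto simp: divide_le_eq_1)

context
  fixes w :: "'r \<Rightarrow> real" and U :: "'i \<Rightarrow> 'r set" and g :: "'r \<Rightarrow> ('i, 'o) ptree"
  assumes w: "\<And>i. 0 \<le> w i"
begin

lemma sum_weights_nonneg: "0 \<le> (\<Sum>j\<leftarrow>l. w j)"
  using w by (auto intro!: sum_list_nonneg)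

lemma sum_weights_indicator_nonneg: "0 \<le> (\<Sum>j\<leftarrow>l. indicator V j * w j)"
  using w by (auto intro!: sum_list_nonneg)

lemma sum_weights_indicator_le: "(\<Sum>j\<leftarrow>l. indicator V j * w j) \<le> (\<Sum>j\<leftarrow>l. w j)"
  using w by (auto intro!: sum_list_mono simp: indicator_def)

lemma wf_tree_send: "(\<And>i. i \<in> set l \<Longrightarrow> wf_tree (g i)) \<Longrightarrow> wf_tree (send s w U g l)"
proof (induction l)
  case (Cons i l)
  thus ?case using w sum_weights_nonneg[of l] sum_weights_indicator_nonneg[of _ l] by (simp add: fraction_bounds)
qed simp

lemma outs_send:
  assumes "0 < (\<Sum>j\<leftarrow>l. indicator (U (own s x y)) j * w j)"
  shows "outs (send s w U g l) x y \<subseteq> (\<Union>i\<in>set l \<inter> U (own s x y). outs (g i) x y)"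
  using assms
proof (induction l)
  case (Cons i l)
  let ?V = "U (own s x y)"
  let ?rest = "\<Sum>j\<leftarrow>l. indicator ?V j * w j"
  show ?case
  proof (cases "?rest = 0")
    \<comment> \<open>All remaining weight sits on \<open>i\<close>, so the bit \<open>True\<close>
      is sent with certainty and the undefined leaf is avoided.\<close>
    case True
    with Cons.prems show ?thesis by (auto simp: indicator_def split: if_splits)
  next
    case False
    hence "outs (send s w U g l) x y \<subseteq> (\<Union>i\<in>set l \<inter> ?V. outs (g i) x y)"
      using sum_weights_indicator_nonneg[of ?V l] by (intro Cons.IH) simp
    thus ?thesis by (auto simp: indicator_def split: if_splits)
  qed
qed simp

text \<open>The weights conditioned on \<open>U\<close> differ from the unconditioned ones by a
  constant factor on every choosable element. The logarithm of this factor is the price of the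
  choice, whichever element is chosen.\<close>

lemma divergence_send:
  assumes "0 < (\<Sum>j\<leftarrow>l. indicator (U (own s x y)) j * w j)"
    and "\<And>i. i \<in> set l \<Longrightarrow> i \<in> U (own s x y) \<Longrightarrow> abs_cont (g i) x y \<and> divergence (g i) x y \<le> D"
  shows "abs_cont (send s w U g l) x y \<and> divergence (send s w U g l) x y \<le>
    log 2 ((\<Sum>j\<leftarrow>l. w j) / (\<Sum>j\<leftarrow>l. indicator (U (own s x y)) j * w j)) + D"
  using assms
proof (induction l)
  case (Cons i l)
  let ?V = "U (own s x y)"
  define u where "u = indicator ?V i * w i"
  define u' where "u' = (\<Sum>j\<leftarrow>l. indicator ?V j * w j)"
  define W' where "W' = (\<Sum>j\<leftarrow>l. w j)"
  define q where "q = u / (u + u')"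
  define r where "r = w i / (w i + W')"
  have nn: "0 \<le> u" "0 \<le> u'" "u' \<le> W'" "u \<le> w i"
    using w[of i] sum_weights_nonneg[of l] sum_weights_indicator_nonneg[of ?V l] sum_weights_indicator_le[of ?V l] by (auto simp: u_def u'_def W'_def indicator_def)
  have pos: "0 < u + u'" using Cons.prems(1) by (simp add: u_def u'_def)
  have q1: "1 - q = u' / (u + u')" using pos by (simp add: q_def field_simps)
  have r1: "1 - r = W' / (w i + W')" using pos nn by (simp add: r_def field_simps)
  let ?L = "log 2 ((w i + W') / (u + u'))"
  let ?S = "send s w U g l"
  have IH: "abs_cont ?S x y \<and> divergence ?S x y \<le> log 2 (W' / u') + D" if "u' \<noteq> 0"
    using Cons.IH Cons.prems(2) that nn(2) by (simp add: u'_def W'_def)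
  have send: "send s w U g (i # l) = Node s
     (\<lambda>x. indicator (U x) i * w i / (\<Sum>j\<leftarrow>i # l. indicator (U x) j * w j)) r (g i) ?S"
    by (simp add: r_def W'_def)
  have qe: "indicator ?V i * w i / (\<Sum>j\<leftarrow>i # l. indicator ?V j * w j) = q"
    by (simp add: q_def u_def u'_def)
  have iV: "i \<in> ?V" "u = w i" "0 < u" if "u \<noteq> 0" using that nn(1) by (auto simp: u_def indicator_def split: if_splits)
  have head: "q * (log 2 (q / r) + divergence (g i) x y) \<le> q * (?L + D)"
  proof (cases "u = 0")
    case False
    have "q / r = (w i + W') / (u + u')" using iV[OF False] pos by (simp add: q_def r_def)
    thus ?thesis using Cons.prems(2)[of i] iV[OF False] pos by (intro mult_left_mono) (auto simp: q_def)
  qed (simp add: q_def)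
  have tail: "(1 - q) * (log 2 ((1 - q) / (1 - r)) + divergence ?S x y) \<le> (1 - q) * (?L + D)"
  proof (cases "u' = 0")
    case False
    hence "0 < u'" "0 < W'" using nn by auto
    moreover from this have "(1 - q) / (1 - r) = (u' * (w i + W')) / ((u + u') * W')" unfolding q1 r1 by simp
    \<comment> \<open>The ratio of the bit \<open>False\<close> times the ratio for the shorter list
      telescopes to the ratio for the full list.\<close>
    ultimately have "log 2 ((1 - q) / (1 - r)) + log 2 (W' / u') = ?L"
      using nn pos by (simp add: log_mult log_divide)
    thus ?thesis using IH[OF False] \<open>0 < u'\<close> pos nn unfolding q1 by (intro mult_left_mono) auto
  qed (simp add: q1)
  have "divergence (send s w U g (i # l)) x y \<le> q * (?L + D) + (1 - q) * (?L + D)"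
    unfolding send divergence.simps Let_def qe using head tail by (rule add_mono)
  also have "\<dots> = ?L + D" by (simp add: algebra_simps)
  finally have div: "divergence (send s w U g (i # l)) x y \<le> ?L + D" .
  have ac: "abs_cont (send s w U g (i # l)) x y" unfolding send abs_cont.simps qe
  proof (intro conjI impI)
    assume "q \<noteq> 0"
    hence "u \<noteq> 0" by (auto simp: q_def)
    from iV[OF this] show "0 < r" "abs_cont (g i) x y" using nn Cons.prems(2)[of i] by (auto simp: r_def)
  next
    assume "q \<noteq> 1"
    hence u': "u' \<noteq> 0" using pos by (auto simp: q_def)
    show "abs_cont ?S x y" using IH[OF u'] by simp
    have "0 < W'" using u' nn by simp
    hence "0 < W' / (w i + W')" using nn by simp
    thus "r < 1" using r1 by simp
  qed
  show ?case using div ac by (simp add: u_def u'_def W'_def)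
qed simp

end

subsection \<open>The rectangle-halving protocol\<close>

definition side :: "bool \<Rightarrow> 'i set \<times> 'i set \<Rightarrow> 'i set" where
  "side s R = (if s then fst R else snd R)"

definition is_one :: "('i \<Rightarrow> 'i \<Rightarrow> bool) \<Rightarrow> 'i set \<times> 'i set \<Rightarrow> bool" where
  "is_one f R \<longleftrightarrow> (\<forall>x\<in>fst R. \<forall>y\<in>snd R. f x y)"

text \<open>If the input of player \<open>s\<close> lies in side \<open>s\<close> of
  \<open>Q\<close>, these are the only members of \<open>L\<close> that can still contain the input
  pair.\<close>

definition meeting :: "bool \<Rightarrow> ('i set \<times> 'i set) set \<Rightarrow> 'i set \<times> 'i set \<Rightarrow> ('i set \<times> 'i set) set" where
  "meeting s L Q = {S \<in> L. side s Q \<inter> side s S \<noteq> {}}"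

locale halving =
  fixes A B :: "'i set" and f :: "'i \<Rightarrow> 'i \<Rightarrow> bool" and P :: "('i set \<times> 'i set) pmf" and \<delta> :: real
  assumes finP: "finite (set_pmf P)" and monoP: "set_pmf P \<subseteq> mono_rects A B f"
    and \<delta>: "0 < \<delta>" "\<delta> \<le> 1"
begin

text \<open>Apart from the public set \<open>L\<close>, the condition involves the speaker's input
  only, so the speaker can decide it alone.\<close>

definition halving_rects :: "bool \<Rightarrow> ('i set \<times> 'i set) set \<Rightarrow> 'i \<Rightarrow> ('i set \<times> 'i set) set" where
  "halving_rects s L x = {Q \<in> set_pmf P. is_one f Q \<and> x \<in> side s Q \<and> measure P (meeting s L Q) \<le> measure P L / 2}"

definition rect_list :: "('i set \<times> 'i set) list" where
  "rect_list = (SOME l. set l = set_pmf P \<and> distinct l)"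

text \<open>The set L consists of the 0-rectangles that may still contain the input.  The player
holding x names a 1-rectangle by sampling it from P conditioned on the admissible ones, which
carries at most log (2 / \<delta>) bits of external information relative to the prior P.\<close>

fun halving_tree :: "nat \<Rightarrow> ('i set \<times> 'i set) set \<Rightarrow> ('i, bool) ptree" where
  "halving_tree 0 L = Leaf True"
| "halving_tree (Suc r) L = (if measure P L \<le> \<delta> then Leaf True else
     Node True (\<lambda>x. if \<delta> / 2 \<le> measure P (halving_rects True L x) then 1 else 0) (1 / 2)
       (send True (pmf P) (halving_rects True L) (\<lambda>Q. halving_tree r (meeting True L Q)) rect_list)
       (Node False (\<lambda>y. if \<delta> / 2 \<le> measure P (halving_rects False L y) then 1 else 0) (1 / 2)
         (send False (pmf P) (halving_rects False L) (\<lambda>Q. halving_tree r (meeting False L Q)) rect_list)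
         (Leaf False)))"

lemma rect_list: "set rect_list = set_pmf P" "distinct rect_list"
  unfolding rect_list_def using someI_ex[OF finite_distinct_list[OF finP]] by auto

lemma sum_rect_list: "(\<Sum>Q\<leftarrow>rect_list. pmf P Q) = 1"
  using rect_list sum_pmf_set[OF finP] by (simp add: sum_list_distinct_conv_sum_set)

lemma sum_indicator_rect_list: "(\<Sum>Q\<leftarrow>rect_list. indicator V Q * pmf P Q) = measure P V"
proof -
  have "(\<Sum>Q\<leftarrow>rect_list. indicator V Q * pmf P Q) = (\<Sum>Q\<in>set_pmf P. indicator V Q * pmf P Q)"
    using rect_list by (simp add: sum_list_distinct_conv_sum_set)
  also have "\<dots> = measure_pmf.expectation P (indicator V)"
    by (subst integral_measure_pmf[OF finP]) (auto simp: mult.commute)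
  finally show ?thesis by simp
qed

lemma wf_halving_tree: "wf_tree (halving_tree r L)"
  by (induction r arbitrary: L) (auto intro!: wf_tree_send)

text \<open>Names are sampled from an event of mass at least \<open>\<delta> / 2\<close>, so naming
  costs at most the logarithm of \<open>2 / \<delta>\<close>.\<close>

lemma divergence_halving_send:
  assumes "\<delta> / 2 \<le> measure P (halving_rects s L (own s x y))"
    and "\<And>Q. abs_cont (g Q) x y \<and> divergence (g Q) x y \<le> D"
  shows "abs_cont (send s (pmf P) (halving_rects s L) g rect_list) x y \<and>
    divergence (send s (pmf P) (halving_rects s L) g rect_list) x y \<le> log 2 (2 / \<delta>) + D"
proof -
  let ?m = "measure P (halving_rects s L (own s x y))"
  have m: "0 < ?m" using assms(1) \<delta> by linarith
  have "log 2 (1 / ?m) \<le> log 2 (2 / \<delta>)"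
    using assms(1) \<delta> m by (subst log_le_cancel_iff) (auto simp: field_simps)
  thus ?thesis
    using divergence_send[where w = "pmf P" and l = rect_list and U = "halving_rects s L" and s = s
        and x = x and y = y and g = g and D = D] assms(2) m
    by (auto simp: sum_indicator_rect_list sum_rect_list intro: order_trans)
qed

text \<open>A round has at most two announcement bits, each deterministic given the input and
  costing exactly 1 against the prior 1/2, and at most one name.\<close>

lemma divergence_halving_tree:
  "abs_cont (halving_tree r L) x y \<and> divergence (halving_tree r L) x y \<le> real r * (2 + log 2 (2 / \<delta>))"
proof (induction r arbitrary: L)
  case (Suc r)
  let ?D = "real r * (2 + log 2 (2 / \<delta>))"
  have log: "0 \<le> log 2 (2 / \<delta>)" using \<delta> by simp
  hence D: "0 \<le> ?D" by simp
  have D': "real (Suc r) * (2 + log 2 (2 / \<delta>)) = ?D + 2 + log 2 (2 / \<delta>)" by (simp add: algebra_simps)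
  have send: "abs_cont (send s (pmf P) (halving_rects s L) (\<lambda>Q. halving_tree r (meeting s L Q)) rect_list) x y \<and>
      divergence (send s (pmf P) (halving_rects s L) (\<lambda>Q. halving_tree r (meeting s L Q)) rect_list) x y
        \<le> log 2 (2 / \<delta>) + ?D"
    if "\<delta> / 2 \<le> measure P (halving_rects s L (own s x y))" for s
    using that by (rule divergence_halving_send) (rule Suc.IH)
  show ?case
  proof (cases "measure P L \<le> \<delta>")
    case True
    thus ?thesis using D log by (simp add: D')
  next
    case False
    show ?thesis
      using False D log send[of True] send[of False]
      unfolding D' by (auto simp: Let_def own_def)
  qed
qed simp

text \<open>Invariant: \<open>L\<close> holds only 0-rectangles, contains every rectangle around the
  input if the value is 0, and has mass at most \<open>\<delta> * 2 ^ r\<close> with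
  \<open>r\<close> rounds left. Each name halves the mass. The protocol stops with
  \<open>True\<close> when the mass is too small for a 0-input, and with \<open>False\<close> when
  neither player has enough names.\<close>

lemma outs_halving_tree:
  assumes good: "\<delta> < measure P {R. in_rect R (x, y)}"
  shows "measure P L \<le> \<delta> * 2 ^ r \<Longrightarrow> L \<subseteq> {S \<in> set_pmf P. \<not> is_one f S} \<Longrightarrow>
    (\<not> f x y \<Longrightarrow> {S \<in> set_pmf P. in_rect S (x, y)} \<subseteq> L) \<Longrightarrow> outs (halving_tree r L) x y \<subseteq> {f x y}"
proof (induction r arbitrary: L)
  \<comment> \<open>On a 0-input \<open>L\<close> would contain all rectangles around the input,
    whose mass exceeds \<delta>.\<close>
  have stop: "f x y" if "measure P L \<le> \<delta>" "\<not> f x y \<Longrightarrow> {S \<in> set_pmf P. in_rect S (x, y)} \<subseteq> L" for L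
  proof (rule ccontr)
    assume "\<not> f x y"
    with that(2) have "{S \<in> set_pmf P. in_rect S (x, y)} \<subseteq> L" by blast
    hence "measure P {S \<in> set_pmf P. in_rect S (x, y)} \<le> measure P L"
      by (rule measure_pmf.finite_measure_mono) simp
    moreover have "measure P {S \<in> set_pmf P. in_rect S (x, y)} = measure P {R. in_rect R (x, y)}"
      by (rule measure_pmf.finite_measure_eq_AE) (auto intro!: AE_pmfI)
    ultimately show False using that(1) good by linarith
  qed
  {
    case 0
    thus ?case using stop[of L] by simp
  next
    case (Suc r)
    show ?case
    proof (cases "measure P L \<le> \<delta>")
      case True
      thus ?thesis using stop[OF True Suc.prems(3)] by simp
    next
      case False
      have sub: "outs (send s (pmf P) (halving_rects s L) (\<lambda>Q. halving_tree r (meeting s L Q)) rect_list) x y \<subseteq> {f x y}"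
        if half: "\<delta> / 2 \<le> measure P (halving_rects s L (own s x y))" for s
      proof -
        have "outs (halving_tree r (meeting s L Q)) x y \<subseteq> {f x y}" if Q: "Q \<in> halving_rects s L (own s x y)" for Q
        proof (rule Suc.IH)
          show "measure P (meeting s L Q) \<le> \<delta> * 2 ^ r"
            using Q Suc.prems(1) by (simp add: halving_rects_def)
          show "meeting s L Q \<subseteq> {S \<in> set_pmf P. \<not> is_one f S}"
            using Suc.prems(2) by (auto simp: meeting_def)
          show "{S \<in> set_pmf P. in_rect S (x, y)} \<subseteq> meeting s L Q" if "\<not> f x y"
          proof
            fix S assume S: "S \<in> {S \<in> set_pmf P. in_rect S (x, y)}"
            hence "own s x y \<in> side s Q \<inter> side s S"
              using Q by (auto simp: halving_rects_def side_def own_def in_rect_def)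
            thus "S \<in> meeting s L Q" using Suc.prems(3)[OF that] S by (auto simp: meeting_def)
          qed
        qed
        moreover have "0 < measure P (halving_rects s L (own s x y))" using half \<delta> by linarith
        hence "outs (send s (pmf P) (halving_rects s L) (\<lambda>Q. halving_tree r (meeting s L Q)) rect_list) x y \<subseteq>
          (\<Union>Q\<in>set rect_list \<inter> halving_rects s L (own s x y). outs (halving_tree r (meeting s L Q)) x y)"
          by (intro outs_send) (simp_all add: sum_indicator_rect_list)
        ultimately show ?thesis by blast
      qed
      have neither: "\<not> f x y" if "\<not> \<delta> / 2 \<le> measure P (halving_rects True L x)" "\<not> \<delta> / 2 \<le> measure P (halving_rects False L y)"
      proof
        assume fxy: "f x y"
        have "{R \<in> set_pmf P. in_rect R (x, y)} \<subseteq> halving_rects True L x \<union> halving_rects False L y"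
        proof
          fix Q assume Q: "Q \<in> {R \<in> set_pmf P. in_rect R (x, y)}"
          then obtain c where "\<forall>x\<in>fst Q. \<forall>y\<in>snd Q. f x y = c" using monoP by (force simp: mono_rects_def)
          hence one: "is_one f Q" using Q fxy by (auto simp: is_one_def in_rect_def)
          \<comment> \<open>A 0-rectangle sharing both a row and a column with the 1-rectangle
            \<open>Q\<close> would share an entry with it. Hence \<open>Q\<close> meets at most half
            of \<open>L\<close> on one of the two sides.\<close>
          have "meeting True L Q \<inter> meeting False L Q = {}"
          proof (rule ccontr)
            assume "meeting True L Q \<inter> meeting False L Q \<noteq> {}"
            then obtain S a b where S: "S \<in> L" "a \<in> fst Q" "a \<in> fst S" "b \<in> snd Q" "b \<in> snd S"
              by (auto simp: meeting_def side_def)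
            moreover obtain c where "\<forall>x\<in>fst S. \<forall>y\<in>snd S. f x y = c"
              using monoP Suc.prems(2) S(1) by (force simp: mono_rects_def)
            moreover have "\<not> is_one f S" using Suc.prems(2) S(1) by auto
            ultimately show False using one by (auto simp: is_one_def)
          qed
          hence "measure P (meeting True L Q) + measure P (meeting False L Q) = measure P (meeting True L Q \<union> meeting False L Q)"
            by (intro measure_pmf.finite_measure_Union[symmetric]) auto
          also have "\<dots> \<le> measure P L"
            by (intro measure_pmf.finite_measure_mono) (auto simp: meeting_def)
          finally have "measure P (meeting True L Q) \<le> measure P L / 2 \<or> measure P (meeting False L Q) \<le> measure P L / 2"
            by linarith
          thus "Q \<in> halving_rects True L x \<union> halving_rects False L y"
            using Q one by (auto simp: halving_rects_def side_def in_rect_def)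
        qed
        hence "measure P {R \<in> set_pmf P. in_rect R (x, y)} \<le> measure P (halving_rects True L x \<union> halving_rects False L y)"
          by (rule measure_pmf.finite_measure_mono) simp
        also have "\<dots> \<le> measure P (halving_rects True L x) + measure P (halving_rects False L y)"
          by (intro measure_Un_le) auto
        \<comment> \<open>Two masses below \<open>\<delta> / 2\<close> cannot cover all rectangles
          around the input; this fixes the threshold at \<open>\<delta> / 2\<close>.\<close>
        also have "\<dots> < \<delta>" using that by linarith
        also have "measure P {R \<in> set_pmf P. in_rect R (x, y)} = measure P {R. in_rect R (x, y)}"
          by (rule measure_pmf.finite_measure_eq_AE) (auto intro!: AE_pmfI)
        finally show False using good by simp
      qed
      show ?thesis
        using False sub[of True] sub[of False] neither by (auto simp: own_def)
    qed
  }
qed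

end

section \<open>From a random monochromatic rectangle to external information\<close>

lemma IC_ext_le:
  assumes fin: "finite (set_pmf \<mu>)" and v: "valid_protocol P A B" and e: "error_prob \<mu> P g \<le> \<epsilon>"
    and "ext_info \<mu> P \<le> D"
  shows "IC_ext A B \<mu> g \<epsilon> \<le> D"
proof -
  have "IC_ext A B \<mu> g \<epsilon> \<le> ext_info \<mu> P"
    unfolding IC_ext_def
  proof (rule cInf_lower)
    show "bdd_below {ext_info \<mu> P | P. valid_protocol P A B \<and> error_prob \<mu> P g \<le> \<epsilon>}"
      by (rule bdd_belowI[of _ 0]) (auto intro: ext_info_nonneg[OF fin])
  qed (use v e in auto)
  with assms(4) show ?thesis by linarith
qed

lemma code_len_pos_measure:
  assumes "R \<in> set_pmf P" "mem R z"
  shows "0 < measure P {R. mem R z}" "0 \<le> code_len mem P z"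
proof -
  show *: "0 < measure P {R. mem R z}" using assms by (intro measure_pmf_posI) auto
  show "0 \<le> code_len mem P z" using * by (simp add: code_len_def)
qed

lemma finite_mono_rects: "finite A \<Longrightarrow> finite B \<Longrightarrow> finite (mono_rects A B f)"
  by (rule finite_subset[of _ "Pow A \<times> Pow B"]) (auto simp: mono_rects_def)

text \<open>Markov's inequality at \<open>k = K / \<epsilon>\<close> discards inputs of long code
  length; on the rest a protocol that does not err is run. The case \<open>k \<le> 1\<close> is
  separate because there \<open>8 * k\<^sup>2\<close> cannot absorb the additive constants of the
  halving protocol.\<close>

lemma IC_ext_le_code_len:
  fixes f :: "'i \<Rightarrow> 'i \<Rightarrow> bool"
  assumes finA: "finite A" "finite B" and \<epsilon>: "0 < \<epsilon>" and K: "0 < K"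
    and fin: "finite (set_pmf \<mu>)"
    and P: "set_pmf P \<subseteq> mono_rects A B f" "\<And>z. z \<in> set_pmf \<mu> \<Longrightarrow> \<exists>R\<in>set_pmf P. in_rect R z"
    and E: "measure_pmf.expectation \<mu> (code_len in_rect P) \<le> K"
  shows "IC_ext A B \<mu> f \<epsilon> \<le> 8 / \<epsilon>\<^sup>2 * K\<^sup>2"
proof -
  define k where "k = K / \<epsilon>"
  define \<delta> where "\<delta> = 2 powr (- k)"
  define Bad where "Bad = {z. k \<le> code_len in_rect P z}"
  have k: "0 < k" using K \<epsilon> by (simp add: k_def)
  have \<delta>: "0 < \<delta>" "\<delta> \<le> 1" using k powr_mono[of "- k" 0 "2 :: real"] by (auto simp: \<delta>_def)
  have bound: "8 / \<epsilon>\<^sup>2 * K\<^sup>2 = 8 * k\<^sup>2" by (simp add: k_def power_divide)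
  have nonneg: "0 \<le> code_len in_rect P z" "0 < measure P {R. in_rect R z}" if z: "z \<in> set_pmf \<mu>" for z
  proof -
    obtain R where R: "R \<in> set_pmf P" "in_rect R z" using P(2)[OF z] by blast
    show "0 \<le> code_len in_rect P z" "0 < measure P {R. in_rect R z}"
      by (rule code_len_pos_measure[where mem = in_rect, OF R])+
  qed
  \<comment> \<open>Markov's inequality, with \<open>k * indicator Bad\<close> as the minorant of
    the nonnegative code length.\<close>
  have "k * measure \<mu> Bad = measure_pmf.expectation \<mu> (\<lambda>z. k * indicator Bad z)" by simp
  also have "\<dots> \<le> measure_pmf.expectation \<mu> (code_len in_rect P)"
    by (intro integral_mono_AE integrable_measure_pmf_finite[OF fin] AE_pmfI)
       (auto simp: Bad_def indicator_def nonneg)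
  also have "\<dots> \<le> K" by (rule E)
  also have "K = k * \<epsilon>" using \<epsilon> by (simp add: k_def)
  finally have Bad: "measure \<mu> Bad \<le> \<epsilon>" using k by simp
  have good: "\<delta> < measure P {R. in_rect R z}" if "z \<in> set_pmf \<mu>" "z \<notin> Bad" for z
  proof -
    have "- k < log 2 (measure P {R. in_rect R z})" using that(2) by (simp add: Bad_def code_len_def)
    thus ?thesis using nonneg(2)[OF that(1)] by (simp add: \<delta>_def less_log_iff)
  qed
  have finP: "finite (set_pmf P)" by (rule finite_subset[OF P(1) finite_mono_rects[OF finA]])
  show ?thesis
  proof (cases "k \<le> 1")
    case True
    have half: "1 / 2 \<le> \<delta>" using True powr_mono[of "-1" "-k" "2::real"] by (simp add: \<delta>_def powr_minus_divide)
    \<comment> \<open>If no good input exists, \<open>c\<close> is \<open>False\<close> and the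
      claim about good inputs is vacuous.\<close>
    define c where "c = (\<exists>z\<in>set_pmf \<mu> - Bad. f (fst z) (snd z))"
    have const: "f (fst z) (snd z) = f (fst z') (snd z')" if "z \<in> set_pmf \<mu> - Bad" "z' \<in> set_pmf \<mu> - Bad" for z z'
    proof -
      have "\<exists>R\<in>set_pmf P. in_rect R z \<and> in_rect R z'"
      \<comment> \<open>Two disjoint families of rectangles would each have mass above 1/2.\<close>
      proof (rule ccontr)
        assume neg: "\<not> (\<exists>R\<in>set_pmf P. in_rect R z \<and> in_rect R z')"
        have "measure P {R \<in> set_pmf P. in_rect R u} = measure P {R. in_rect R u}" for u :: "'i \<times> 'i"
          by (rule measure_pmf.finite_measure_eq_AE) (auto intro!: AE_pmfI)
        hence "measure P {R. in_rect R z} + measure P {R. in_rect R z'} =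
            measure P ({R \<in> set_pmf P. in_rect R z} \<union> {R \<in> set_pmf P. in_rect R z'})"
          using neg by (subst measure_pmf.finite_measure_Union) auto
        also have "\<dots> \<le> 1" by simp
        finally show False using good[of z] good[of z'] that half by simp
      qed
      then obtain R where "R \<in> mono_rects A B f" "in_rect R z" "in_rect R z'" using P(1) by blast
      thus ?thesis by (auto simp: mono_rects_def in_rect_def)
    qed
    let ?T = "Leaf c :: ('i, bool) ptree"
    show ?thesis
    proof (rule IC_ext_le[OF fin valid_tree])
      show "wf_tree ?T" by simp
      have c: "f (fst z) (snd z) = c" if z: "z \<in> set_pmf \<mu> - Bad" for z
        unfolding c_def using const[OF z] z by metis
      have "error_prob \<mu> (tree_protocol ?T) f \<le> measure \<mu> Bad"
        by (rule error_prob_tree_le[OF fin]) (simp_all add: c)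
      thus "error_prob \<mu> (tree_protocol ?T) f \<le> \<epsilon>" using Bad by simp
      have "ext_info \<mu> (tree_protocol ?T) \<le> 0" by (rule ext_info_tree_le[OF fin]) auto
      also have "0 \<le> 8 / \<epsilon>\<^sup>2 * K\<^sup>2" by simp
      finally show "ext_info \<mu> (tree_protocol ?T) \<le> 8 / \<epsilon>\<^sup>2 * K\<^sup>2" .
    qed
  next
    case False
    interpret halving A B f P \<delta> by unfold_locales (fact finP P(1) \<delta>)+
    define r where "r = nat \<lceil>k\<rceil>"
    define L where "L = {S \<in> set_pmf P. \<not> is_one f S}"
    have r: "k \<le> real r" "real r \<le> 2 * k" using False by (auto simp: r_def) linarith+
    let ?T = "halving_tree r L"
    have "measure P L \<le> 1" by simp
    also have "1 = \<delta> * 2 powr k" by (simp add: \<delta>_def flip: powr_add)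
    also have "\<dots> \<le> \<delta> * 2 powr real r" using r \<delta> by (intro mult_left_mono powr_mono) auto
    also have "\<dots> = \<delta> * 2 ^ r" by (simp add: powr_realpow)
    finally have PL: "measure P L \<le> \<delta> * 2 ^ r" .
    show ?thesis
    proof (rule IC_ext_le[OF fin valid_tree])
      show "wf_tree ?T" by (rule wf_halving_tree)
      have "error_prob \<mu> (tree_protocol ?T) f \<le> measure \<mu> Bad"
      proof (rule error_prob_tree_le[OF fin wf_halving_tree])
        fix z assume z: "z \<in> set_pmf \<mu>" "z \<notin> Bad"
        show "outs ?T (fst z) (snd z) \<subseteq> {f (fst z) (snd z)}"
          by (rule outs_halving_tree) (use good[OF z] PL in \<open>auto simp: L_def is_one_def in_rect_def\<close>)
      qed
      thus "error_prob \<mu> (tree_protocol ?T) f \<le> \<epsilon>" using Bad by simp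
      have "log 2 (2 / \<delta>) = 1 + k" by (simp add: \<delta>_def log_divide log_powr)
      hence "ext_info \<mu> (tree_protocol ?T) \<le> real r * (3 + k)"
        using divergence_halving_tree by (intro ext_info_tree_le[OF fin wf_halving_tree]) fastforce+
      \<comment> \<open>For \<open>k > 1\<close> rounding up gives \<open>r \<le> 2 * k\<close>, and
        \<open>3 + k \<le> 4 * k\<close>; this is the origin of the constant 8.\<close>
      also have "\<dots> \<le> (2 * k) * (4 * k)" using r False by (intro mult_mono) auto
      also have "\<dots> = 8 / \<epsilon>\<^sup>2 * K\<^sup>2" unfolding bound by (simp add: power2_eq_square)
      finally show "ext_info \<mu> (tree_protocol ?T) \<le> 8 / \<epsilon>\<^sup>2 * K\<^sup>2" .
    qed
  qed
qed

subsection \<open>The amortized zero-error cost\<close>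

text \<open>With a singleton as admissible set, \<open>send\<close> names the speaker's input with
  certainty.\<close>

definition announce :: "bool \<Rightarrow> ('i \<Rightarrow> ('i, 'o) ptree) \<Rightarrow> 'i list \<Rightarrow> ('i, 'o) ptree" where
  "announce s = send s (\<lambda>_. 1) (\<lambda>x. {x})"

lemma outs_announce:
  assumes "own s x y \<in> set l"
  shows "outs (announce s g l) x y \<subseteq> outs (g (own s x y)) x y"
proof -
  have "0 < (\<Sum>j\<leftarrow>l. indicator {own s x y} j * (1 :: real))"
    using assms
  proof (induction l)
    case (Cons a l)
    have "0 \<le> (\<Sum>j\<leftarrow>l. indicator {own s x y} j * (1 :: real))" by (rule sum_list_nonneg) auto
    thus ?case using Cons by (auto simp: indicator_def)
  qed simp
  hence "outs (announce s g l) x y \<subseteq> (\<Union>i\<in>set l \<inter> {own s x y}. outs (g i) x y)"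
    unfolding announce_def by (intro outs_send) auto
  thus ?thesis by auto
qed

lemma zero_error_protocol_exists:
  fixes g :: "'i \<Rightarrow> 'i \<Rightarrow> 'o"
  assumes "finite A" "finite B"
  shows "\<exists>P :: ('i, 'i, 'o) protocol. valid_protocol P A B \<and> zero_error P A B g \<and> (\<forall>x y. cost P x y < \<top>)"
proof -
  obtain as bs where l: "set as = A" "set bs = B" using assms finite_list by metis
  define T where "T = announce True (\<lambda>a. announce False (\<lambda>b. Leaf (g a b)) bs) as"
  have wf: "wf_tree T" by (auto simp: T_def announce_def intro!: wf_tree_send)
  have "zero_error (tree_protocol T) A B g"
    unfolding zero_error_def
  proof (intro ballI allI impI)
    fix x y t assume xy: "x \<in> A" "y \<in> B" and "trans_prob (tree_protocol T) x y t \<noteq> 0"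
    hence "outp (tree_protocol T) t \<in> outs T x y" by (simp add: trans_prob_tree outp_tree)
    also have "outs T x y \<subseteq> outs (announce False (\<lambda>b. Leaf (g x b)) bs) x y"
      using outs_announce[of True x y as] xy l by (simp add: T_def own_def)
    also have "\<dots> \<subseteq> {g x y}"
      using outs_announce[of False x y bs "\<lambda>b. Leaf (g x b)"] xy l by (simp add: own_def)
    finally show "outp (tree_protocol T) t = g x y" by simp
  qed
  thus ?thesis using valid_tree[OF wf] cost_tree_finite[OF wf] by blast
qed

text \<open>Announcing both inputs has finite cost. Finiteness matters because
  \<open>enn2real\<close> sends infinity to 0.\<close>

lemma CC0_finite:
  fixes g :: "'i \<Rightarrow> 'i \<Rightarrow> 'o"
  assumes "finite A" "finite B" "finite (set_pmf \<nu>)"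
  shows "CC0 A B \<nu> g < \<top>"
proof -
  obtain P :: "('i, 'i, 'o) protocol" where P: "valid_protocol P A B" "zero_error P A B g" "\<And>x y. cost P x y < \<top>"
    using zero_error_protocol_exists[OF assms(1,2)] by blast
  have "CC0 A B \<nu> g \<le> exp_comm \<nu> P" unfolding CC0_def by (rule INF_lower) (use P in auto)
  also have "\<dots> < \<top>" unfolding exp_comm_def cost_def[symmetric]
    using P(3) assms(3)
    by (auto simp: case_prod_unfold less_top[symmetric] ennreal_sum_eq_top ennreal_mult_eq_top_iff)
  finally show ?thesis .
qed

theorem theorem1p5:
  shows "\<exists>C>0. \<forall>\<epsilon>>0. \<forall>(n::nat) (f :: bool list \<Rightarrow> bool list \<Rightarrow> bool)
           (\<mu> :: (bool list \<times> bool list) pmf).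
     set_pmf \<mu> \<subseteq> cube n \<times> cube n \<longrightarrow>
     IC_ext (cube n) (cube n) \<mu> f \<epsilon>
       \<le> C / \<epsilon>^2 * (lim (\<lambda>q. enn2real (CC0 (cube_pow n q) (cube_pow n q) (mu_pow \<mu> q) (f_pow f))
                                / real q))^2"
proof (intro exI[of _ 8] conjI allI impI)
  fix \<epsilon> :: real and n and f :: "bool list \<Rightarrow> bool list \<Rightarrow> bool" and \<mu> :: "(bool list \<times> bool list) pmf"
  assume \<epsilon>: "0 < \<epsilon>" and \<mu>: "set_pmf \<mu> \<subseteq> cube n \<times> cube n"
  let ?CC = "\<lambda>q. CC0 (cube_pow n q) (cube_pow n q) (mu_pow \<mu> q) (f_pow f)"
  define a where "a = (\<lambda>q. enn2real (?CC q))"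
  define K where "K = lim (\<lambda>q. a q / real q)"
  have fin: "finite (set_pmf \<mu>)" using \<mu> finite_cube finite_subset by blast
  have CC_fin: "?CC q < \<top>" for q
    by (intro CC0_finite finite_cube_pow finite_mu_pow[OF fin])
  have "a (p + q) \<le> a p + a q" for p q
  proof -
    have "a (p + q) \<le> enn2real (?CC p + ?CC q)"
      unfolding a_def by (intro enn2real_mono CC0_subadditive[OF \<mu>]) (use CC_fin in auto)
    also have "\<dots> = a p + a q" unfolding a_def by (rule enn2real_plus[OF CC_fin CC_fin])
    finally show ?thesis .
  qed
  moreover have "0 \<le> a q" for q by (simp add: a_def)
  ultimately have "convergent (\<lambda>q. a q / real q)" by (rule fekete_convergent)
  hence lim: "(\<lambda>q. a q / real q) \<longlonglongrightarrow> K" unfolding K_def by (simp add: convergent_LIMSEQ_iff)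
  have K: "0 \<le> K" by (rule LIMSEQ_le_const[OF lim]) (auto simp: a_def)
  \<comment> \<open>If every covering distribution on rectangles had average code length at least
    \<open>K'\<close>, then \<open>q\<close> copies would cost at least \<open>q * K'\<close>, and
    the limit \<open>K\<close> could not be below \<open>K'\<close>.\<close>
  have le: "IC_ext (cube n) (cube n) \<mu> f \<epsilon> \<le> 8 / \<epsilon>\<^sup>2 * K'\<^sup>2" if K': "K < K'" for K'
  proof -
    have "\<exists>P. set_pmf P \<subseteq> mono_rects (cube n) (cube n) f \<and> (\<forall>z\<in>set_pmf \<mu>. \<exists>R\<in>set_pmf P. in_rect R z) \<and>
      measure_pmf.expectation \<mu> (code_len in_rect P) < K'"
    proof (rule ccontr)
      assume neg: "\<not> ?thesis"
      have single: "K' \<le> measure_pmf.expectation \<mu> (code_len in_rect Q)"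
        if "set_pmf Q \<subseteq> mono_rects (cube n) (cube n) f" "\<forall>z\<in>set_pmf \<mu>. \<exists>R\<in>set_pmf Q. in_rect R z" for Q
        using neg that by (meson not_less)
      have "ennreal (real q * K') \<le> ?CC q" for q
        unfolding CC0_def
      proof (rule INF_greatest, clarify)
        fix P :: "(bool list list, bool list list, bool list) protocol"
        assume "valid_protocol P (cube_pow n q) (cube_pow n q)" "zero_error P (cube_pow n q) (cube_pow n q) (f_pow f)"
        thus "ennreal (real q * K') \<le> exp_comm (mu_pow \<mu> q) P"
          by (intro exp_comm_lower[OF \<mu>, where f = f] single)
      qed
      hence "real q * K' \<le> a q" for q
        using enn2real_mono[of "ennreal (real q * K')" "?CC q"] CC_fin[of q] K K' by (simp add: a_def)
      hence "K' \<le> a q / real q" if "1 \<le> q" for q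
        using that by (simp add: field_simps)
      hence "K' \<le> K" by (intro LIMSEQ_le_const[OF lim]) blast
      thus False using K' by simp
    qed
    then obtain P where P: "set_pmf P \<subseteq> mono_rects (cube n) (cube n) f" "\<forall>z\<in>set_pmf \<mu>. \<exists>R\<in>set_pmf P. in_rect R z"
      "measure_pmf.expectation \<mu> (code_len in_rect P) < K'" by blast
    show ?thesis
      by (rule IC_ext_le_code_len[OF finite_cube finite_cube \<epsilon> _ fin P(1)]) (use P K K' in auto)
  qed
  \<comment> \<open>Letting \<open>K'\<close> decrease to \<open>K\<close> also covers
    \<open>K = 0\<close>, where the positivity hypothesis of \<open>IC_ext_le_code_len\<close> fails
    for \<open>K\<close> itself.\<close>
  have "(\<lambda>m. 8 / \<epsilon>\<^sup>2 * (K + 1 / real (Suc m))\<^sup>2) \<longlonglongrightarrow> 8 / \<epsilon>\<^sup>2 * (K + 0)\<^sup>2"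
    by (intro tendsto_intros LIMSEQ_Suc[OF lim_1_over_n])
  hence "IC_ext (cube n) (cube n) \<mu> f \<epsilon> \<le> 8 / \<epsilon>\<^sup>2 * (K + 0)\<^sup>2"
  proof (rule LIMSEQ_le_const)
    show "\<exists>N. \<forall>m\<ge>N. IC_ext (cube n) (cube n) \<mu> f \<epsilon> \<le> 8 / \<epsilon>\<^sup>2 * (K + 1 / real (Suc m))\<^sup>2"
      by (intro exI[of _ 0] allI impI le) simp
  qed
  thus "IC_ext (cube n) (cube n) \<mu> f \<epsilon> \<le> 8 / \<epsilon>\<^sup>2 * (lim (\<lambda>q. enn2real (?CC q) / real q))\<^sup>2"
    by (simp add: K_def a_def)
qed simp

end
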